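(* There exist positive constants $z_0\geq 1$, $C_0$ and $A_0\geq 1$ such that for every $z\geq z_0$ and every $\nu\geq 0$ the following holds. (i) If either $\nu=0$, or $\nu>0$ and $\frac{z-\nu}{\nu^{1/3}}\geq C_0$, then $$A_0^{-1}\frac{1}{(z^2-\nu^2)^{1/4}}\leq |H^{(1)}_{\nu}(z)|\leq A_0\frac{1}{(z^2-\nu^2)^{1/4}}.$$ (ii) If $\nu>0$ and $\frac{|z-\nu|}{\nu^{1/3}}\leq C_0$, then $$A_0^{-1}\nu^{-1/3}\leq |H^{(1)}_{\nu}(z)|\leq A_0\nu^{-1/3}.$$ (iii) If $\nu>0$ and $\frac{\nu-z}{\nu^{1/3}}\geq C_0$, then $$A_0^{-1}\exp(\eta_2)\frac{1}{(\nu^2-z^2)^{1/4}}\leq |H^{(1)}_{\nu}(z)|\leq A_0\exp(\eta_2)\frac{1}{(\nu^2-z^2)^{1/4}},$$ where $$\eta_2=\eta_2(z,\nu)=\nu\log\left(\frac{\nu}{z}+\left(\left(\frac{\nu}{z}\right)^2-1\right)^{1/2}\right)-(\nu^2-z^2)^{1/2}.$$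
   Context: $H^{(1)}_\nu(z)=J_\nu(z)+\mathrm{i}Y_\nu(z)$ denotes the Hankel function of the first kind of real order $\nu\geq 0$ and argument $z>0$, where $J_\nu$ and $Y_\nu$ are the Bessel functions of the first and second kind. *)

theory Defs
  imports "HOL-Analysis.Analysis"
begin

text \<open>
  Bessel functions of real order and positive real argument; the values at arguments
  \<open>x \<le> 0\<close> carry no meaning. The order may be negative: \<open>rGamma = 1 / \<Gamma>\<close> is entire and vanishes
  at the non-positive integers, so the usual ascending series
  \<open>\<Sum>k. (-1)^k (x/2)^(\<nu>+2k) / (k! \<Gamma>(\<nu>+k+1))\<close> covers all real \<open>\<nu>\<close>.
\<close>

definition bessel_J :: "real \<Rightarrow> real \<Rightarrow> real" where
  "bessel_J \<nu> x =
     (\<Sum>k. (-1) ^ k * rGamma (\<nu> + real k + 1) / fact k * (x / 2) powr (\<nu> + 2 * real k))"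

definition bessel_Y_quotient :: "real \<Rightarrow> real \<Rightarrow> real" where
  "bessel_Y_quotient \<nu> x =
     (bessel_J \<nu> x * cos (\<nu> * pi) - bessel_J (- \<nu>) x) / sin (\<nu> * pi)"

text \<open>
  At integer order the quotient is of the form \<open>0/0\<close>, and \<open>Y\<close> is its limit in the order.
  The filter \<open>at \<nu>\<close> excludes \<open>\<nu>\<close> itself.
\<close>

definition bessel_Y :: "real \<Rightarrow> real \<Rightarrow> real" where
  "bessel_Y \<nu> x =
     (if \<nu> \<in> \<int> then Lim (at \<nu>) (\<lambda>\<mu>. bessel_Y_quotient \<mu> x)
      else bessel_Y_quotient \<nu> x)"

definition hankel_H1 :: "real \<Rightarrow> real \<Rightarrow> complex" where
  "hankel_H1 \<nu> x = complex_of_real (bessel_J \<nu> x) + \<i> * complex_of_real (bessel_Y \<nu> x)"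

definition eta2 :: "real \<Rightarrow> real \<Rightarrow> real" where
  "eta2 z \<nu> = \<nu> * ln (\<nu> / z + sqrt ((\<nu> / z)\<^sup>2 - 1)) - sqrt (\<nu>\<^sup>2 - z\<^sup>2)"

end

theory Submission
  imports Defs
begin

text \<open>
  Schlaefli's integrals give \<open>\<pi> H(\<nu>, z)\<close> as \<open>\<integral>\<^sub>0\<^sup>\<pi> exp (\<i> (z sin \<theta> - \<nu> \<theta>)) d\<theta>\<close> minus \<open>\<i>\<close> times
  \<open>\<integral>\<^sub>0\<^sup>\<infinity> (exp (\<nu> s) + exp (- \<nu> s - \<i> \<nu> \<pi>)) exp (- z sinh s) ds\<close>; they follow from the power series by inserting
  Hankel's loop integral for \<open>1 / \<Gamma>\<close> term by term, the loop having radius \<open>z / 2\<close>. The upper bounds come from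
  van der Corput's first derivative test away from the stationary point \<open>cos \<theta> = \<nu> / z\<close> and from Laplace's method
  for the second integral. When \<open>z\<close> is not much smaller than \<open>\<nu>\<close>, the lower bound is dual to an upper bound:
  the cross product \<open>J(\<nu>+1) Y(\<nu>) - J(\<nu>) Y(\<nu>+1) = 2 / (\<pi> z)\<close> yields
  \<open>\<bar>H(\<nu>)\<bar> \<bar>H(\<nu>-1) - H(\<nu>+1)\<bar> \<ge> 4 / (\<pi> z)\<close>, and the difference has the same integral representation with extra
  factors \<open>sin \<theta>\<close> and \<open>sinh s\<close>. In the exponential regime the Laplace peak \<open>cosh s = \<nu> / z\<close> dominates
  everything else.
\<close>

subsection \<open>Hankel's loop integral for the reciprocal Gamma function\<close>

text \<open>A direct lower bound for |H| would require control of the cancellation between the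
  integrals, uniformly in the order. Upper bounds do not, since each piece may be estimated by its
  absolute value; hence the detour through the cross product, which asks only for upper bounds. At
  radius r = z/2 the series over k sums to exp(-r e^{-i\<theta>}), whose modulus cancels that of
  exp(r e^{i\<theta>}), so a pure phase is left. The working scale is \<sigma> with \<sigma>^4 =
  |z^2 - \<nu>^2|: the second derivative of the exponent at its critical point has size \<sigma>^2,
  so windows have width about 1/\<sigma>. Near z = \<nu> this degenerates, and the cubic term sets
  the scale n = \<nu>^(1/3). The value 200 of \<open>C0\<close> is large because of the exponential
  regime, where P and Q carry no exponential factor and only \<eta> \<ge> 0 is used: it forces \<nu>
  - z \<ge> 40 \<sigma>, which makes them small beside the peak. The price is a wide transition
  region with the constant exp 10050.\<close>

lemma integrable_atLeast_dominated:
  fixes f g :: "real \<Rightarrow> real"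
  assumes "continuous_on {a..} f" "\<And>x. x \<ge> a \<Longrightarrow> \<bar>f x\<bar> \<le> g x" "g integrable_on {a..}"
  shows "f integrable_on {a..}"
proof (rule integrable_on_all_intervals_integrable_bound[OF _ _ assms(3)])
  fix c d :: real
  have "{a..} \<inter> cbox c d = {max a c..d}" by auto
  moreover have "f integrable_on {max a c..d}"
    by (intro integrable_continuous_interval continuous_on_subset[OF assms(1)]) auto
  ultimately show "(\<lambda>x. if x \<in> {a..} then f x else 0) integrable_on cbox c d"
    by (metis integrable_restrict_Int)
qed (use assms(2) in auto)

lemma sums_integral_dominated:
  fixes f :: "nat \<Rightarrow> real \<Rightarrow> real"
  assumes "\<And>k. f k integrable_on S" "h integrable_on S"
    "\<And>n x. x \<in> S \<Longrightarrow> \<bar>\<Sum>k<n. f k x\<bar> \<le> h x" "\<And>x. x \<in> S \<Longrightarrow> (\<lambda>k. f k x) sums g x"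
  shows "g integrable_on S" "(\<lambda>k. integral S (f k)) sums integral S g"
proof -
  have i: "\<And>n. (\<lambda>x. \<Sum>k<n. f k x) integrable_on S"
    by (intro integrable_sum assms) auto
  have b: "\<And>n x. x \<in> S \<Longrightarrow> norm (\<Sum>k<n. f k x) \<le> h x" using assms(3) by simp
  have l: "\<And>x. x \<in> S \<Longrightarrow> (\<lambda>n. \<Sum>k<n. f k x) \<longlonglongrightarrow> g x" using assms(4) by (simp add: sums_def)
  show "g integrable_on S" by (rule dominated_convergence(1)[OF i assms(2) b l])
  have "(\<lambda>n. integral S (\<lambda>x. \<Sum>k<n. f k x)) \<longlonglongrightarrow> integral S g"
    by (rule dominated_convergence(2)[OF i assms(2) b l])
  then show "(\<lambda>k. integral S (f k)) sums integral S g"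
    using assms(1) by (simp add: sums_def integral_sum)
qed

text \<open>Dominating function for integrating exponential series term by term: \<open>c k\<close>
  holds the cosines or powers of modulus at most 1 that accompany \<open>r ^ k / fact k\<close>, so
  one bound serves all partial sums.\<close>

lemma abs_exp_partial_sum_le:
  fixes r :: real
  assumes "\<And>k. \<bar>c k\<bar> \<le> 1"
  shows "\<bar>\<Sum>k<n. r ^ k / fact k * c k\<bar> \<le> exp \<bar>r\<bar>"
proof -
  have "\<bar>\<Sum>k<n. r ^ k / fact k * c k\<bar> \<le> (\<Sum>k<n. \<bar>r\<bar> ^ k / fact k)"
    using assms by (intro sum_abs[THEN order_trans] sum_mono)
      (auto simp: abs_mult power_abs intro!: divide_right_mono mult_left_le)
  also have "\<dots> \<le> (\<Sum>k. \<bar>r\<bar> ^ k / fact k)"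
    using summable_exp[of "\<bar>r\<bar>"] by (intro sum_le_suminf) (auto simp: field_simps)
  also have "\<dots> = exp \<bar>r\<bar>"
    by (simp add: exp_def divide_inverse mult.commute)
  finally show ?thesis .
qed

text \<open>Truncation at \<open>a + real n\<close> reduces this to a compact interval; the
  truncated integrands converge pointwise and stay below \<open>g\<close>.\<close>

lemma has_integral_FTC_atLeast:
  fixes f F g :: "real \<Rightarrow> real"
  assumes c: "continuous_on {a..} f" and b: "\<And>x. x \<ge> a \<Longrightarrow> \<bar>f x\<bar> \<le> g x" and g: "g integrable_on {a..}"
    and d: "\<And>x. x \<ge> a \<Longrightarrow> (F has_real_derivative f x) (at x)" and l: "(F \<longlongrightarrow> L) at_top"
  shows "(f has_integral (L - F a)) {a..}"
proof -
  define h where "h = (\<lambda>(n::nat) x. if x \<in> {a..a + real n} then f x else 0)"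
  have ftc: "(f has_integral (F (a + real n) - F a)) {a..a + real n}" for n
    by (intro fundamental_theorem_of_calculus)
      (auto intro!: has_field_derivative_at_within d
        simp flip: has_real_derivative_iff_has_vector_derivative)
  have hi: "(h n has_integral (F (a + real n) - F a)) {a..}" for n
    unfolding h_def using ftc[of n] by (subst has_integral_restrict) auto
  show ?thesis
  proof (rule has_integral_dominated_convergence[OF hi g])
    show "\<forall>x\<in>{a..}. norm (h k x) \<le> g x" for k
      using b by (auto simp: h_def intro: order_trans[OF abs_ge_zero])
    show "\<forall>x\<in>{a..}. (\<lambda>k. h k x) \<longlonglongrightarrow> f x"
    proof
      fix x assume "x \<in> {a..}"
      moreover obtain N where "x - a < real N" using reals_Archimedean2 by blast
      ultimately have "\<forall>n\<ge>N. h n x = f x" by (auto simp: h_def)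
      then show "(\<lambda>k. h k x) \<longlonglongrightarrow> f x"
        by (intro tendsto_eventually) (auto simp: eventually_sequentially)
    qed
    have "filterlim (\<lambda>n. a + real n) at_top sequentially"
      by (intro filterlim_tendsto_add_at_top[OF tendsto_const] filterlim_real_sequentially)
    then show "(\<lambda>k. F (a + real k) - F a) \<longlonglongrightarrow> L - F a"
      using filterlim_compose[OF l] by (auto intro!: tendsto_intros)
  qed
qed

lemma exp_cos_sums:
  "(\<lambda>n. r ^ n / fact n * cos (real n * \<theta> + \<phi>)) sums (exp (r * cos \<theta>) * cos (r * sin \<theta> + \<phi>))"
proof -
  have "(\<lambda>n. (of_real r * cis \<theta>) ^ n /\<^sub>R fact n * cis \<phi>) sums (exp (of_real r * cis \<theta>) * cis \<phi>)"
    by (intro sums_mult2 exp_converges)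
  then have "(\<lambda>n. Re ((of_real r * cis \<theta>) ^ n /\<^sub>R fact n * cis \<phi>)) sums Re (exp (of_real r * cis \<theta>) * cis \<phi>)"
    by (rule sums_Re)
  moreover have "Re ((of_real r * cis \<theta>) ^ n /\<^sub>R fact n * cis \<phi>) = r ^ n / fact n * cos (real n * \<theta> + \<phi>)" for n
    by (simp add: power_mult_distrib Complex.DeMoivre cis_mult divide_inverse mult.assoc flip: of_real_power)
  moreover have "Re (exp (of_real r * cis \<theta>) * cis \<phi>) = exp (r * cos \<theta>) * cos (r * sin \<theta> + \<phi>)"
    by (simp add: exp_eq_polar cis_mult mult.assoc)
  ultimately show ?thesis by simp
qed

text \<open>The loop runs along the negative axis below the cut, around the circle of radius \<open>r\<close> and back;
  \<open>hankel_arc\<close> is the contribution of the upper half circle, and \<open>hankel_ray\<close> that of the axis at \<open>-r exp s\<close>.\<close>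

definition hankel_arc :: "real \<Rightarrow> real \<Rightarrow> real" where
  "hankel_arc r \<alpha> = integral {0..pi} (\<lambda>\<theta>. exp (r * cos \<theta>) * cos (r * sin \<theta> + \<alpha> * \<theta>))"

definition hankel_ray :: "real \<Rightarrow> real \<Rightarrow> real" where
  "hankel_ray r \<alpha> = integral {0..} (\<lambda>s. exp (\<alpha> * s - r * exp s))"

text \<open>From exp s \<ge> s^2/2 the exponent is at most a concave quadratic. Completing the
  square after setting aside one extra s leaves the factor exp(-s), which dominates integrably for
  every real \<alpha>.\<close>

lemma hankel_ray_bound:
  assumes "r > 0" "s \<ge> (0::real)"
  shows "exp (\<alpha> * s - r * exp s) \<le> exp ((\<alpha> + 1)\<^sup>2 / (2 * r)) * exp (- 1 * s)"
proof -
  have "r * (s\<^sup>2 / 2) \<le> r * exp s"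
    using assms exp_lower_Taylor_quadratic[of s] by (intro mult_left_mono) auto
  moreover have "(\<alpha> + 1) * s - r * (s\<^sup>2 / 2) \<le> (\<alpha> + 1)\<^sup>2 / (2 * r)"
  proof -
    have "0 \<le> (\<alpha> + 1 - r * s)\<^sup>2" by simp
    then show ?thesis using assms by (simp add: field_simps power2_eq_square)
  qed
  ultimately show ?thesis by (simp flip: exp_add) (simp add: algebra_simps)
qed

lemma exp_dominant_integrable: "(\<lambda>s. c * exp (- 1 * s)) integrable_on {0::real..}"
  by (intro integrable_on_mult_right integrable_on_exp_minus_to_infinity) auto

lemma hankel_ray_integrable:
  fixes r \<alpha> :: real
  assumes "r > 0"
  shows "(\<lambda>s. exp (\<alpha> * s - r * exp s)) integrable_on {0..}"
  by (rule integrable_atLeast_dominated[OF _ _ exp_dominant_integrable])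
    (use hankel_ray_bound[OF assms] in \<open>auto intro!: continuous_intros\<close>)

text \<open>The left-hand integrand is the derivative of \<open>exp (r * cos \<theta>) * sin (r *
  sin \<theta> + \<beta> * \<theta>)\<close>. This is the functional equation of 1/\<Gamma> on the
  arc, up to a boundary term at \<pi> that the ray has to cancel.\<close>

lemma hankel_arc_rec: "r * hankel_arc r (\<beta> + 1) + \<beta> * hankel_arc r \<beta> = exp (- r) * sin (\<beta> * pi)"
proof -
  define f where "f = (\<lambda>\<beta> \<theta>. exp (r * cos \<theta>) * cos (r * sin \<theta> + \<beta> * \<theta>))"
  have i: "(f \<beta> has_integral hankel_arc r \<beta>) {0..pi}" for \<beta>
    unfolding hankel_arc_def f_def
    by (intro integrable_integral integrable_continuous_interval continuous_intros)
  have "((\<lambda>\<theta>. r * f (\<beta> + 1) \<theta> + \<beta> * f \<beta> \<theta>) has_integral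
      (exp (r * cos pi) * sin (r * sin pi + \<beta> * pi) - exp (r * cos 0) * sin (r * sin 0 + \<beta> * 0))) {0..pi}"
    unfolding f_def
    by (rule fundamental_theorem_of_calculus)
      (auto intro!: derivative_eq_intros simp flip: has_real_derivative_iff_has_vector_derivative
        simp: algebra_simps cos_add sin_add)
  from has_integral_unique[OF this has_integral_add[OF has_integral_mult_right[OF i] has_integral_mult_right[OF i]]]
  show ?thesis by simp
qed

text \<open>Integration by parts along the ray. Its boundary term exp(-r), weighted with
  sin((\<beta>+1)\<pi>) = -sin(\<beta>\<pi>), cancels the one of the arc.\<close>

lemma hankel_ray_rec:
  assumes "r > 0"
  shows "r * hankel_ray r (\<beta> + 1) = \<beta> * hankel_ray r \<beta> + exp (- r)"
proof -
  define f where "f = (\<lambda>\<beta> s. exp (\<beta> * s - r * exp s))"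
  have i: "(f \<beta> has_integral hankel_ray r \<beta>) {0..}" for \<beta>
    unfolding hankel_ray_def f_def by (intro integrable_integral hankel_ray_integrable assms)
  have b: "\<bar>\<beta> * f \<beta> s - r * f (\<beta> + 1) s\<bar> \<le> \<bar>\<beta>\<bar> * f \<beta> s + r * f (\<beta> + 1) s" for s
    using assms by (intro order_trans[OF abs_triangle_ineq4]) (auto simp: abs_mult f_def)
  have "((\<lambda>s. \<beta> * f \<beta> s - r * f (\<beta> + 1) s) has_integral (0 - f \<beta> 0)) {0..}"
  proof (rule has_integral_FTC_atLeast[OF _ b])
    show "continuous_on {0..} (\<lambda>s. \<beta> * f \<beta> s - r * f (\<beta> + 1) s)"
      unfolding f_def by (intro continuous_intros)
    show "(\<lambda>s. \<bar>\<beta>\<bar> * f \<beta> s + r * f (\<beta> + 1) s) integrable_on {0..}"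
      by (intro integrable_add integrable_on_mult_right has_integral_integrable[OF i])
    show "(f \<beta> has_real_derivative \<beta> * f \<beta> s - r * f (\<beta> + 1) s) (at s)" for s
      unfolding f_def
      by (rule derivative_eq_intros refl)+ (simp add: algebra_simps exp_diff exp_add diff_divide_distrib)
    show "(f \<beta> \<longlongrightarrow> 0) at_top"
    proof (rule tendsto_sandwich[OF _ _ tendsto_const])
      show "\<forall>\<^sub>F s in at_top. f \<beta> s \<le> exp ((\<beta> + 1)\<^sup>2 / (2 * r)) * exp (- 1 * s)"
        using eventually_ge_at_top[of 0]
        by eventually_elim (use hankel_ray_bound[OF assms] in \<open>simp add: f_def\<close>)
      have "((\<lambda>s::real. exp (- s)) \<longlongrightarrow> 0) at_top"
        by (rule filterlim_compose[OF exp_at_bot filterlim_uminus_at_bot_at_top])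
      then show "((\<lambda>s. exp ((\<beta> + 1)\<^sup>2 / (2 * r)) * exp (- 1 * s)) \<longlongrightarrow> 0) at_top"
        using tendsto_mult_right_zero by auto
    qed (auto simp: f_def)
  qed
  from has_integral_unique[OF this has_integral_diff[OF has_integral_mult_right[OF i] has_integral_mult_right[OF i]]]
  show ?thesis by (simp add: f_def)
qed

section \<open>Arc and ray as incomplete Gamma functions, and continuation in \<alpha>\<close>

lemma has_integral_cos_linear:
  assumes "c \<noteq> 0"
  shows "((\<lambda>\<theta>. cos (c * \<theta>)) has_integral sin (c * pi) / c) {0..pi}"
proof -
  have "((\<lambda>\<theta>. cos (c * \<theta>)) has_integral (sin (c * pi) / c - sin (c * 0) / c)) {0..pi}"
    using assms by (intro fundamental_theorem_of_calculus)
      (auto intro!: derivative_eq_intros simp flip: has_real_derivative_iff_has_vector_derivative)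
  then show ?thesis by simp
qed

lemma sin_nat_add_times_pi: "sin ((real n + \<alpha>) * pi) = (- 1) ^ n * sin (\<alpha> * pi)"
  by (simp add: distrib_right sin_add sin_npi cos_npi)

lemma hankel_arc_sums:
  "(\<lambda>n. r ^ n / fact n * integral {0..pi} (\<lambda>\<theta>. cos ((real n + \<alpha>) * \<theta>))) sums hankel_arc r \<alpha>"
proof -
  have "(\<lambda>n. integral {0..pi} (\<lambda>\<theta>. r ^ n / fact n * cos ((real n + \<alpha>) * \<theta>))) sums hankel_arc r \<alpha>"
    unfolding hankel_arc_def
  proof (rule sums_integral_dominated(2))
    show "(\<lambda>\<theta>. r ^ n / fact n * cos ((real n + \<alpha>) * \<theta>)) integrable_on {0..pi}" for n
      by (intro integrable_continuous_interval continuous_intros)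
    show "(\<lambda>\<theta>. exp \<bar>r\<bar>) integrable_on {0..pi}" by (intro integrable_const_ivl)
    show "\<bar>\<Sum>k<n. r ^ k / fact k * cos ((real k + \<alpha>) * \<theta>)\<bar> \<le> exp \<bar>r\<bar>" for n \<theta>
      by (rule abs_exp_partial_sum_le) auto
    show "(\<lambda>k. r ^ k / fact k * cos ((real k + \<alpha>) * \<theta>)) sums
        (exp (r * cos \<theta>) * cos (r * sin \<theta> + \<alpha> * \<theta>))" for \<theta>
      using exp_cos_sums[of r \<theta> "\<alpha> * \<theta>"] by (simp add: distrib_right)
  qed
  then show ?thesis by simp
qed

text \<open>The value \<alpha> = 0 needs its own argument: the recurrence carries a factor \<alpha>
  there and gives no information. In the series every term but n = 0 integrates to zero.\<close>

lemma hankel_arc_0: "hankel_arc r 0 = pi"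
proof -
  have "integral {0..pi} (\<lambda>\<theta>. cos (real n * \<theta>)) = (if n = 0 then pi else 0)" for n
    using integral_unique[OF has_integral_cos_linear[of "real n"]] by (auto simp: sin_npi)
  then have "(\<lambda>n. r ^ n / fact n * (if n = 0 then pi else 0)) sums hankel_arc r 0"
    using hankel_arc_sums[of r 0] by simp
  moreover have "(\<lambda>n. r ^ n / fact n * (if n = 0 then pi else 0)) sums pi"
    using sums_single[of 0 "\<lambda>n. r ^ n / fact n * pi"] by (simp add: if_distrib cong: if_cong)
  ultimately show ?thesis using sums_unique2 by blast
qed

text \<open>Both sides have the same series. Expanding exp(-t) under the lower incomplete Gamma
  integral gives (-1)^n r^(\<alpha>+n) / (n! (\<alpha>+n)), and integrating
  cos((n+\<alpha>)\<theta>) over the half circle gives (-1)^n sin(\<alpha>\<pi>)/(n+\<alpha>).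
  Positivity of \<alpha> makes the integral converge at 0.\<close>

lemma hankel_arc_incomplete_Gamma:
  assumes r: "r > 0" and \<alpha>: "\<alpha> > 0"
  shows "(\<lambda>t. t powr (\<alpha> - 1) / exp t) integrable_on {0..r}"
    and "r powr \<alpha> * hankel_arc r \<alpha> = sin (\<alpha> * pi) * integral {0..r} (\<lambda>t. t powr (\<alpha> - 1) / exp t)"
proof -
  define f where "f = (\<lambda>n t. (- 1) ^ n / fact n * t powr (\<alpha> - 1 + real n))"
  have fi: "(f n has_integral ((- 1) ^ n / fact n * (r powr (\<alpha> + real n) / (\<alpha> + real n)))) {0..r}" for n
    unfolding f_def
    using has_integral_mult_right[OF has_integral_powr_from_0[of "\<alpha> - 1 + real n" r], of "(- 1) ^ n / fact n"] assms
    by (simp add: add.commute)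
  have eq: "f n t = (- t) ^ n / fact n * t powr (\<alpha> - 1)" if "t > 0" for n t
    using that by (simp add: f_def powr_add powr_realpow power_minus[of t])
  \<comment> \<open>The convention that 0 \<open>powr\<close> anything is 0 makes series and
    integrand agree at the endpoint, even for negative exponents.\<close>
  have eq0: "f n 0 = 0" for n by (simp add: f_def)
  have A: "f n integrable_on {0..r}" for n using fi by blast
  have B: "(\<lambda>t. exp r * t powr (\<alpha> - 1)) integrable_on {0..r}"
    using assms by (intro integrable_on_mult_right integrable_on_powr_from_0) auto
  have C: "\<bar>\<Sum>k<n. f k t\<bar> \<le> exp r * t powr (\<alpha> - 1)" if "t \<in> {0..r}" for n t
  proof (cases "t = 0")
    case False
    with that have t: "0 < t" "t \<le> r" by auto
    have "\<bar>\<Sum>k<n. f k t\<bar> = \<bar>\<Sum>k<n. (- t) ^ k / fact k * 1\<bar> * t powr (\<alpha> - 1)"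
      using t by (simp add: eq abs_mult flip: sum_distrib_right times_divide_eq_left)
    also have "\<dots> \<le> exp \<bar>- t\<bar> * t powr (\<alpha> - 1)"
      by (intro mult_right_mono abs_exp_partial_sum_le) auto
    also have "\<dots> \<le> exp r * t powr (\<alpha> - 1)" using t by (intro mult_right_mono) auto
    finally show ?thesis .
  qed (simp add: eq0)
  have D: "(\<lambda>k. f k t) sums (t powr (\<alpha> - 1) / exp t)" if "t \<in> {0..r}" for t
  proof (cases "t = 0")
    case False
    with that have t: "0 < t" by auto
    have "(\<lambda>k. (- t) ^ k /\<^sub>R fact k * t powr (\<alpha> - 1)) sums (exp (- t) * t powr (\<alpha> - 1))"
      by (intro sums_mult2 exp_converges)
    then show ?thesis using t by (simp add: eq exp_minus field_simps)
  qed (simp add: eq0)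
  show "(\<lambda>t. t powr (\<alpha> - 1) / exp t) integrable_on {0..r}"
    by (rule sums_integral_dominated(1)[OF A B C D])
  have "(\<lambda>n. integral {0..r} (f n)) sums integral {0..r} (\<lambda>t. t powr (\<alpha> - 1) / exp t)"
    by (rule sums_integral_dominated(2)[OF A B C D])
  then have "(\<lambda>n. sin (\<alpha> * pi) * ((- 1) ^ n / fact n * (r powr (\<alpha> + real n) / (\<alpha> + real n)))) sums
      (sin (\<alpha> * pi) * integral {0..r} (\<lambda>t. t powr (\<alpha> - 1) / exp t))"
    using integral_unique[OF fi] by (intro sums_mult) simp
  moreover have "(\<lambda>n. r powr \<alpha> * (r ^ n / fact n * integral {0..pi} (\<lambda>\<theta>. cos ((real n + \<alpha>) * \<theta>)))) sums
      (r powr \<alpha> * hankel_arc r \<alpha>)"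
    by (intro sums_mult hankel_arc_sums)
  moreover have "r powr \<alpha> * (r ^ n / fact n * integral {0..pi} (\<lambda>\<theta>. cos ((real n + \<alpha>) * \<theta>))) =
      sin (\<alpha> * pi) * ((- 1) ^ n / fact n * (r powr (\<alpha> + real n) / (\<alpha> + real n)))" for n
    using integral_unique[OF has_integral_cos_linear[of "real n + \<alpha>"]] assms
    by (simp add: sin_nat_add_times_pi powr_add powr_realpow add.commute[of \<alpha>])
  ultimately show "r powr \<alpha> * hankel_arc r \<alpha> = sin (\<alpha> * pi) * integral {0..r} (\<lambda>t. t powr (\<alpha> - 1) / exp t)"
    using sums_unique2 by simp
qed

text \<open>The substitution t = r exp s turns the ray into the upper incomplete Gamma integral; its
  Jacobian is the value g s itself.\<close>

lemma hankel_ray_incomplete_Gamma: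
  assumes r: "r > 0"
  shows "((\<lambda>t. t powr (\<alpha> - 1) / exp t) has_integral (r powr \<alpha> * hankel_ray r \<alpha>)) {r..}"
proof -
  define g where "g = (\<lambda>s. r * exp s)"
  define f where "f = (\<lambda>t. t powr (\<alpha> - 1) / exp t)"
  have eq: "\<bar>g s\<bar> * f (g s) = r powr \<alpha> * exp (\<alpha> * s - r * exp s)" for s
  proof -
    have "\<bar>g s\<bar> * g s powr (\<alpha> - 1) = g s powr \<alpha>"
      using r by (simp add: g_def powr_diff)
    also have "\<dots> = r powr \<alpha> * exp (\<alpha> * s)"
      using r by (simp add: g_def powr_def ln_mult distrib_left exp_add)
    finally show ?thesis by (simp add: f_def g_def exp_diff)
  qed
  have int: "((\<lambda>s. r powr \<alpha> * exp (\<alpha> * s - r * exp s)) has_integral (r powr \<alpha> * hankel_ray r \<alpha>)) {0..}"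
    unfolding hankel_ray_def
    by (intro has_integral_mult_right integrable_integral hankel_ray_integrable r)
  have "(\<lambda>s. r powr \<alpha> * exp (\<alpha> * s - r * exp s)) absolutely_integrable_on {0..}"
    using int by (intro nonnegative_absolutely_integrable_1) auto
  then have 1: "(\<lambda>s. \<bar>g s\<bar> * f (g s)) absolutely_integrable_on {0..} \<and>
      integral {0..} (\<lambda>s. \<bar>g s\<bar> * f (g s)) = r powr \<alpha> * hankel_ray r \<alpha>"
    using integral_unique[OF int] by (simp add: eq)
  have "g ` {0..} = {r..}"
  proof (intro antisym subsetI)
    fix t assume "t \<in> {r..}"
    then have "t = g (ln (t / r))" "ln (t / r) \<in> {0..}" using r by (auto simp: g_def)
    then show "t \<in> g ` {0..}" by blast
  qed (use r in \<open>auto simp: g_def\<close>)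
  moreover have "((\<lambda>s. \<bar>g s\<bar> * f (g s)) absolutely_integrable_on {0..} \<and>
      integral {0..} (\<lambda>s. \<bar>g s\<bar> * f (g s)) = r powr \<alpha> * hankel_ray r \<alpha>) \<longleftrightarrow>
      (f absolutely_integrable_on g ` {0..} \<and> integral (g ` {0..}) f = r powr \<alpha> * hankel_ray r \<alpha>)"
  proof (rule has_absolute_integral_change_of_variables_1')
    show "(g has_real_derivative g s) (at s within {0..})" for s
      unfolding g_def by (auto intro!: derivative_eq_intros)
    show "inj_on g {0..}" using r by (auto simp: g_def inj_on_def)
  qed auto
  ultimately have "f absolutely_integrable_on {r..}" "integral {r..} f = r powr \<alpha> * hankel_ray r \<alpha>"
    using 1 by auto
  then show ?thesis unfolding f_def
    using set_lebesgue_integral_eq_integral(1) has_integral_iff by blast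
qed

lemma rGamma_reflection_real: "rGamma x * rGamma (1 - x) = sin (x * pi) / (pi::real)"
proof -
  have "complex_of_real (rGamma x * rGamma (1 - x)) = complex_of_real (sin (x * pi) / pi)"
    using rGamma_reflection_complex[of "of_real x"] rGamma_complex_of_real[of "1 - x"]
      sin_of_real[of "x * pi", where 'a = complex]
    by (simp add: rGamma_complex_of_real mult.commute)
  then show ?thesis by (simp only: of_real_eq_iff)
qed

text \<open>The lower and upper incomplete integrals add up to \<Gamma>(\<alpha>), and the
  reflection formula rewrites sin(\<alpha>\<pi>) \<Gamma>(\<alpha>) as
  \<pi>/\<Gamma>(1-\<alpha>).\<close>

lemma rGamma_hankel_pos:
  assumes r: "r > 0" and \<alpha>: "\<alpha> > 0"
  shows "pi * rGamma (1 - \<alpha>) = r powr \<alpha> * (hankel_arc r \<alpha> + sin (\<alpha> * pi) * hankel_ray r \<alpha>)"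
proof -
  let ?f = "\<lambda>t. t powr (\<alpha> - 1) / exp t"
  have "(?f has_integral (integral {0..r} ?f + r powr \<alpha> * hankel_ray r \<alpha>)) ({0..r} \<union> {r..})"
  proof (rule has_integral_Un)
    show "negligible ({0..r} \<inter> {r..})"
      using r by (intro negligible_subset[OF negligible_sing[of r]]) auto
  qed (use hankel_arc_incomplete_Gamma(1)[OF r \<alpha>] hankel_ray_incomplete_Gamma[OF r] in auto)
  moreover have "{0..r} \<union> {r..} = {0..}" using r by auto
  ultimately have "Gamma \<alpha> = integral {0..r} ?f + r powr \<alpha> * hankel_ray r \<alpha>"
    using Gamma_integral_real[OF \<alpha>] has_integral_unique by auto
  moreover have "pi * rGamma (1 - \<alpha>) = sin (\<alpha> * pi) * Gamma \<alpha>"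
    using rGamma_reflection_real[of \<alpha>] Gamma_real_pos[OF \<alpha>]
    unfolding rGamma_inverse_Gamma[of \<alpha>] by (simp add: divide_simps) (simp add: mult_ac)
  ultimately show ?thesis
    using hankel_arc_incomplete_Gamma(2)[OF r \<alpha>] by (simp add: algebra_simps)
qed

text \<open>The Bessel series needs \<alpha> = -(\<nu>+k), which is negative for all large k. Both
  sides satisfy the same recurrence, so each induction step moves the admissible half-line of
  \<alpha> down by one, with \<alpha> = 0 treated apart.\<close>

lemma rGamma_hankel:
  assumes r: "r > 0"
  shows "pi * rGamma (1 - \<alpha>) = r powr \<alpha> * (hankel_arc r \<alpha> + sin (\<alpha> * pi) * hankel_ray r \<alpha>)"
proof -
  have *: "\<alpha> > - real n \<Longrightarrow> ?thesis" for n
  proof (induction n arbitrary: \<alpha>)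
    case 0
    then show ?case using rGamma_hankel_pos[OF r] by simp
  next
    case (Suc n)
    show ?case
    proof (cases "\<alpha> = 0")
      case True
      then show ?thesis using r by (simp add: hankel_arc_0)
    next
      case False
      have IH: "pi * rGamma (1 - (\<alpha> + 1)) =
          r powr (\<alpha> + 1) * (hankel_arc r (\<alpha> + 1) + sin ((\<alpha> + 1) * pi) * hankel_ray r (\<alpha> + 1))"
        using Suc by (intro Suc.IH) auto
      have g: "rGamma (1 - (\<alpha> + 1)) = - \<alpha> * rGamma (1 - \<alpha>)"
        using rGamma_plus1[of "- \<alpha>"] by simp
      have p: "r powr (\<alpha> + 1) = r powr \<alpha> * r"
        using r by (simp add: powr_add)
      have q: "sin ((\<alpha> + 1) * pi) = - sin (\<alpha> * pi)"
        by (simp add: distrib_right sin_add)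
      have "pi * rGamma (1 - (\<alpha> + 1)) = - \<alpha> * (pi * rGamma (1 - \<alpha>))"
        unfolding g by (rule mult.left_commute)
      moreover have "r powr (\<alpha> + 1) * (hankel_arc r (\<alpha> + 1) + sin ((\<alpha> + 1) * pi) * hankel_ray r (\<alpha> + 1)) =
          r powr \<alpha> * (r * hankel_arc r (\<alpha> + 1) - sin (\<alpha> * pi) * (r * hankel_ray r (\<alpha> + 1)))"
        unfolding p q by (simp only: right_diff_distrib distrib_left) (simp add: mult_ac)
      moreover have "r powr \<alpha> * (r * hankel_arc r (\<alpha> + 1) - sin (\<alpha> * pi) * (r * hankel_ray r (\<alpha> + 1))) =
          - \<alpha> * (r powr \<alpha> * (hankel_arc r \<alpha> + sin (\<alpha> * pi) * hankel_ray r \<alpha>))"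
        proof -
        have "r * hankel_arc r (\<alpha> + 1) = exp (- r) * sin (\<alpha> * pi) - \<alpha> * hankel_arc r \<alpha>"
          using hankel_arc_rec[of r \<alpha>] by simp
        then show ?thesis by (simp only: hankel_ray_rec[OF r]) (simp add: algebra_simps)
      qed
      ultimately have "- \<alpha> * (pi * rGamma (1 - \<alpha>)) =
          - \<alpha> * (r powr \<alpha> * (hankel_arc r \<alpha> + sin (\<alpha> * pi) * hankel_ray r \<alpha>))"
        using IH by presburger
      then show ?thesis using False by simp
    qed
  qed
  obtain n where "- \<alpha> < real n" using reals_Archimedean2 by blast
  then show ?thesis using *[of n] by simp
qed

subsection \<open>Schlaefli's integrals\<close>

text \<open>\<open>bessel_P\<close> is \<pi> times the Anger function, and \<open>bessel_Q\<close>
  is -\<pi> times the Weber function.\<close>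

definition bessel_P :: "real \<Rightarrow> real \<Rightarrow> real" where
  "bessel_P \<nu> z = integral {0..pi} (\<lambda>\<theta>. cos (z * sin \<theta> - \<nu> * \<theta>))"

definition bessel_Q :: "real \<Rightarrow> real \<Rightarrow> real" where
  "bessel_Q \<nu> z = integral {0..pi} (\<lambda>\<theta>. sin (z * sin \<theta> - \<nu> * \<theta>))"

text \<open>\<pi> times the associated Anger-Weber function. At order -\<nu> with \<nu> > z it
  carries the exponential growth of Y.\<close>

definition bessel_E :: "real \<Rightarrow> real \<Rightarrow> real" where
  "bessel_E \<nu> z = integral {0..} (\<lambda>s. exp (- (\<nu> * s) - z * sinh s))"

text \<open>The sum over k produces exp(-r e^{-i\<theta>}). Times exp(r e^{i\<theta>}) this is exp(2
  i r sin \<theta>), and the real exponentials cancel.\<close>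

lemma bessel_P_sums:
  "(\<lambda>k. (- r) ^ k / fact k * hankel_arc r (- (\<nu> + real k))) sums bessel_P \<nu> (2 * r)"
proof -
  define f where "f = (\<lambda>k \<theta>. (- r) ^ k / fact k * (exp (r * cos \<theta>) * cos (r * sin \<theta> - (\<nu> + real k) * \<theta>)))"
  have "(\<lambda>k. integral {0..pi} (f k)) sums bessel_P \<nu> (2 * r)"
    unfolding bessel_P_def
  proof (rule sums_integral_dominated(2))
    show "f k integrable_on {0..pi}" for k
      unfolding f_def by (intro integrable_continuous_interval continuous_intros)
    show "(\<lambda>\<theta>. exp \<bar>r\<bar> * exp \<bar>r\<bar>) integrable_on {0..pi}" by (intro integrable_const_ivl)
    show "\<bar>\<Sum>k<n. f k \<theta>\<bar> \<le> exp \<bar>r\<bar> * exp \<bar>r\<bar>" for n \<theta>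
    proof -
      have "(\<Sum>k<n. f k \<theta>) = exp (r * cos \<theta>) * (\<Sum>k<n. (- r) ^ k / fact k * cos (r * sin \<theta> - (\<nu> + real k) * \<theta>))"
        by (simp add: f_def sum_distrib_left mult_ac)
      also have "\<bar>\<dots>\<bar> \<le> exp \<bar>r\<bar> * exp \<bar>- r\<bar>"
        unfolding abs_mult
      proof (intro mult_mono abs_exp_partial_sum_le)
        have "r * cos \<theta> \<le> \<bar>r\<bar> * \<bar>cos \<theta>\<bar>" by (metis abs_ge_self abs_mult)
        also have "\<dots> \<le> \<bar>r\<bar>" by (intro mult_left_le) auto
        finally show "\<bar>exp (r * cos \<theta>)\<bar> \<le> exp \<bar>r\<bar>" by simp
      qed auto
      finally show ?thesis by simp
    qed
    show "(\<lambda>k. f k \<theta>) sums cos (2 * r * sin \<theta> - \<nu> * \<theta>)" for \<theta>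
    proof -
      have "(\<lambda>k. exp (r * cos \<theta>) * ((- r) ^ k / fact k * cos (real k * (- \<theta>) + (r * sin \<theta> - \<nu> * \<theta>))))
          sums (exp (r * cos \<theta>) * (exp (- r * cos (- \<theta>)) * cos (- r * sin (- \<theta>) + (r * sin \<theta> - \<nu> * \<theta>))))"
        by (intro sums_mult exp_cos_sums)
      moreover have "exp (r * cos \<theta>) * (exp (- r * cos (- \<theta>)) * cos (- r * sin (- \<theta>) + (r * sin \<theta> - \<nu> * \<theta>)))
          = cos (2 * r * sin \<theta> - \<nu> * \<theta>)"
        by (simp add: exp_minus algebra_simps)
      moreover have "exp (r * cos \<theta>) * ((- r) ^ k / fact k * cos (real k * (- \<theta>) + (r * sin \<theta> - \<nu> * \<theta>))) = f k \<theta>" for k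
        by (simp add: f_def algebra_simps)
      ultimately show ?thesis by simp
    qed
  qed
  moreover have "integral {0..pi} (f k) = (- r) ^ k / fact k * hankel_arc r (- (\<nu> + real k))" for k
    by (simp add: f_def hankel_arc_def algebra_simps)
  ultimately show ?thesis by simp
qed

text \<open>On the ray the sum over k produces exp(r e^{-s}), which joins exp(-r e^s) to form exp(-2
  r sinh s). Term 0 of the series, up to a constant factor, dominates all partial sums.\<close>

lemma
  assumes "z > 0"
  shows bessel_E_integrable: "(\<lambda>s. exp (- (\<nu> * s) - z * sinh s)) integrable_on {0..}"
    and bessel_E_sums: "(\<lambda>k. (z / 2) ^ k / fact k * hankel_ray (z / 2) (- (\<nu> + real k))) sums bessel_E \<nu> z"
proof -
  define r where "r = z / 2"
  have r: "r > 0" and z: "z = 2 * r" using assms by (auto simp: r_def)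
  define f where "f = (\<lambda>k s. r ^ k / fact k * exp (- (\<nu> + real k) * s - r * exp s))"
  have f_eq: "f k s = r ^ k / fact k * exp (- s) ^ k * exp (- \<nu> * s - r * exp s)" for k s
    by (simp add: f_def algebra_simps exp_diff exp_add exp_minus exp_of_nat2_mult power_inverse divide_simps)
  have A: "f k integrable_on {0..}" for k
    unfolding f_def by (intro integrable_on_mult_right hankel_ray_integrable r)
  have B: "(\<lambda>s. exp \<bar>r\<bar> * exp (- \<nu> * s - r * exp s)) integrable_on {0..}"
    by (intro integrable_on_mult_right hankel_ray_integrable r)
  have C: "\<bar>\<Sum>k<n. f k s\<bar> \<le> exp \<bar>r\<bar> * exp (- \<nu> * s - r * exp s)" if "s \<in> {0..}" for n s
  proof -
    have "\<bar>\<Sum>k<n. f k s\<bar> = \<bar>\<Sum>k<n. r ^ k / fact k * exp (- s) ^ k\<bar> * exp (- \<nu> * s - r * exp s)"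
      by (simp only: f_eq abs_mult abs_exp_cancel flip: sum_distrib_right)
    also have "\<dots> \<le> exp \<bar>r\<bar> * exp (- \<nu> * s - r * exp s)"
      using that by (intro mult_right_mono abs_exp_partial_sum_le) (auto intro!: power_le_one)
    finally show ?thesis .
  qed
  have D: "(\<lambda>k. f k s) sums exp (- (\<nu> * s) - z * sinh s)" for s
  proof -
    have "(\<lambda>k. (r * exp (- s)) ^ k /\<^sub>R fact k * exp (- \<nu> * s - r * exp s)) sums
        (exp (r * exp (- s)) * exp (- \<nu> * s - r * exp s))"
      by (intro sums_mult2 exp_converges)
    moreover have "exp (r * exp (- s)) * exp (- \<nu> * s - r * exp s) = exp (- (\<nu> * s) - z * sinh s)"
      by (simp add: z sinh_field_def diff_divide_distrib right_diff_distrib flip: exp_add)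
    moreover have "(r * exp (- s)) ^ k /\<^sub>R fact k = r ^ k / fact k * exp (- s) ^ k" for k
      by (simp add: power_mult_distrib divide_inverse)
    ultimately show ?thesis by (simp only: f_eq)
  qed
  show "(\<lambda>s. exp (- (\<nu> * s) - z * sinh s)) integrable_on {0..}"
    by (rule sums_integral_dominated(1)[OF A B C D])
  have "(\<lambda>k. integral {0..} (f k)) sums bessel_E \<nu> z"
    unfolding bessel_E_def by (rule sums_integral_dominated(2)[OF A B C D])
  moreover have "integral {0..} (f k) = r ^ k / fact k * hankel_ray r (- (\<nu> + real k))" for k
    by (simp only: f_def hankel_ray_def integral_mult_right)
  ultimately show "(\<lambda>k. (z / 2) ^ k / fact k * hankel_ray (z / 2) (- (\<nu> + real k))) sums bessel_E \<nu> z"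
    by (simp only: r_def)
qed

text \<open>Hankel's formula at \<alpha> = -(\<nu>+k) splits each term into an arc and a ray part.
  The sign in sin((\<nu>+k)\<pi>) = (-1)^k sin(\<nu>\<pi>) absorbs the alternating sign on the ray
  only, hence powers of -r in the sum for P but of r in the sum for E. The form \<open>sums\<close>
  also records convergence, used again below.\<close>

lemma bessel_J_sums:
  assumes "z > 0"
  shows "(\<lambda>k. (- 1) ^ k * rGamma (\<nu> + real k + 1) / fact k * (z / 2) powr (\<nu> + 2 * real k)) sums
    ((bessel_P \<nu> z - sin (\<nu> * pi) * bessel_E \<nu> z) / pi)"
proof -
  define r where "r = z / 2"
  have r: "r > 0" and z: "z = 2 * r" using assms by (auto simp: r_def)
  have a: "(\<lambda>k. (- r) ^ k / fact k * hankel_arc r (- (\<nu> + real k))) sums bessel_P \<nu> z"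
    unfolding z by (rule bessel_P_sums)
  have b: "(\<lambda>k. r ^ k / fact k * hankel_ray r (- (\<nu> + real k))) sums bessel_E \<nu> z"
    unfolding r_def by (rule bessel_E_sums[OF assms])
  have "(\<lambda>k. ((- r) ^ k / fact k * hankel_arc r (- (\<nu> + real k)) -
        sin (\<nu> * pi) * (r ^ k / fact k * hankel_ray r (- (\<nu> + real k)))) / pi) sums
      ((bessel_P \<nu> z - sin (\<nu> * pi) * bessel_E \<nu> z) / pi)"
    using sums_divide[OF sums_diff[OF a sums_mult[OF b, of "sin (\<nu> * pi)"]], of pi] by assumption
  moreover have "((- r) ^ k / fact k * hankel_arc r (- (\<nu> + real k)) -
        sin (\<nu> * pi) * (r ^ k / fact k * hankel_ray r (- (\<nu> + real k)))) / pi =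
      (- 1) ^ k * rGamma (\<nu> + real k + 1) / fact k * r powr (\<nu> + 2 * real k)" for k
  proof -
    define A R where "A = hankel_arc r (- (\<nu> + real k))" and "R = hankel_ray r (- (\<nu> + real k))"
    have "sin (- (\<nu> + real k) * pi) = - ((- 1) ^ k * sin (\<nu> * pi))"
    proof -
      have "- (\<nu> + real k) * pi = - ((real k + \<nu>) * pi)" by (simp add: algebra_simps)
      then show ?thesis by (simp only: sin_minus sin_nat_add_times_pi)
    qed
    moreover have "1 - (- (\<nu> + real k)) = \<nu> + real k + 1" by simp
    moreover note rGamma_hankel[OF r, of "- (\<nu> + real k)"]
    ultimately have "pi * rGamma (\<nu> + real k + 1) = r powr (- (\<nu> + real k)) * (A - (- 1) ^ k * sin (\<nu> * pi) * R)"
      unfolding A_def R_def by (simp only: mult_minus_left minus_mult_minus diff_conv_add_uminus)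
    then have "pi * rGamma (\<nu> + real k + 1) * r powr (\<nu> + 2 * real k) =
        (r powr (- (\<nu> + real k)) * r powr (\<nu> + 2 * real k)) * (A - (- 1) ^ k * sin (\<nu> * pi) * R)"
      by simp
    also have "r powr (- (\<nu> + real k)) * r powr (\<nu> + 2 * real k) = r ^ k"
    proof -
      have "- (\<nu> + real k) + (\<nu> + 2 * real k) = real k" by simp
      then show ?thesis using powr_realpow[OF r, of k] by (simp only: powr_add[symmetric])
    qed
    finally have "rGamma (\<nu> + real k + 1) * r powr (\<nu> + 2 * real k) =
        r ^ k * (A - (- 1) ^ k * sin (\<nu> * pi) * R) / pi"
      by (simp add: eq_divide_eq mult_ac)
    moreover have e: "(- 1 :: real) ^ k * (- 1) ^ k = 1" by (rule minus_one_mult_self)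
    have "(- 1) ^ k * (r ^ k * (A - (- 1) ^ k * sin (\<nu> * pi) * R)) =
        (- r) ^ k * A - ((- 1) ^ k * (- 1) ^ k) * (sin (\<nu> * pi) * (r ^ k * R))"
      by (simp only: power_minus[of r] right_diff_distrib mult_ac)
    ultimately show ?thesis
      by (simp add: A_def R_def diff_divide_distrib mult.assoc mult.commute[of pi] e)
  qed
  ultimately show ?thesis by (simp only: r_def)
qed

lemma bessel_J_schlaefli:
  "z > 0 \<Longrightarrow> bessel_J \<nu> z = (bessel_P \<nu> z - sin (\<nu> * pi) * bessel_E \<nu> z) / pi"
  unfolding bessel_J_def by (rule sums_unique[OF bessel_J_sums, symmetric])

text \<open>The substitution \<theta> to \<pi> - \<theta> expresses order -\<nu> through integrals
  of order \<nu>; this is where the sine integral Q enters.\<close>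

lemma bessel_P_reflect: "bessel_P (- \<nu>) z = cos (\<nu> * pi) * bessel_P \<nu> z - sin (\<nu> * pi) * bessel_Q \<nu> z"
proof -
  define f where "f = (\<lambda>\<theta>. cos (z * sin \<theta> + \<nu> * \<theta>))"
  have "(f has_integral bessel_P (- \<nu>) z) (cbox 0 pi)"
    unfolding f_def bessel_P_def cbox_interval minus_mult_left[symmetric] diff_minus_eq_add
    by (intro integrable_integral integrable_continuous_interval continuous_intros)
  from has_integral_affinity[OF this, of "-1" pi]
  have "((\<lambda>\<theta>. f (pi - \<theta>)) has_integral bessel_P (- \<nu>) z) {0..pi}"
    by (simp add: image_diff_atLeastAtMost)
  moreover have "f (pi - \<theta>) = cos (\<nu> * pi) * cos (z * sin \<theta> - \<nu> * \<theta>) - sin (\<nu> * pi) * sin (z * sin \<theta> - \<nu> * \<theta>)" for \<theta>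
  proof -
    have "z * sin (pi - \<theta>) + \<nu> * (pi - \<theta>) = \<nu> * pi + (z * sin \<theta> - \<nu> * \<theta>)"
      by (simp add: algebra_simps)
    then have "f (pi - \<theta>) = cos (\<nu> * pi + (z * sin \<theta> - \<nu> * \<theta>))" by (simp only: f_def)
    then show ?thesis by (simp only: cos_add)
  qed
  ultimately have "((\<lambda>\<theta>. cos (\<nu> * pi) * cos (z * sin \<theta> - \<nu> * \<theta>) - sin (\<nu> * pi) * sin (z * sin \<theta> - \<nu> * \<theta>))
      has_integral bessel_P (- \<nu>) z) {0..pi}"
    by simp
  moreover have "((\<lambda>\<theta>. cos (\<nu> * pi) * cos (z * sin \<theta> - \<nu> * \<theta>) - sin (\<nu> * pi) * sin (z * sin \<theta> - \<nu> * \<theta>))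
      has_integral (cos (\<nu> * pi) * bessel_P \<nu> z - sin (\<nu> * pi) * bessel_Q \<nu> z)) {0..pi}"
    unfolding bessel_P_def bessel_Q_def
    by (intro has_integral_diff has_integral_mult_right integrable_integral
        integrable_continuous_interval continuous_intros)
  ultimately show ?thesis by (rule has_integral_unique)
qed

text \<open>By reflection P drops out of the numerator, and everything left has the factor
  sin(\<nu>\<pi>). After division nothing singular remains at integer order.\<close>

lemma bessel_Y_quotient_schlaefli:
  assumes "z > 0" "\<nu> \<notin> \<int>"
  shows "bessel_Y_quotient \<nu> z = (bessel_Q \<nu> z - bessel_E (- \<nu>) z - cos (\<nu> * pi) * bessel_E \<nu> z) / pi"
proof -
  have "sin (\<nu> * pi) \<noteq> 0" using assms by (simp add: sin_times_pi_eq_0)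
  then show ?thesis using assms(1)
    by (simp add: bessel_Y_quotient_def bessel_J_schlaefli bessel_P_reflect field_simps)
qed

section \<open>Continuity in the order, and passage to integer orders\<close>

lemma isCont_bessel_P: "isCont (\<lambda>\<nu>. bessel_P \<nu> z) \<nu>"
proof -
  have "continuous_on UNIV (\<lambda>\<nu>. integral (cbox 0 pi) (\<lambda>\<theta>. cos (z * sin \<theta> - \<nu> * \<theta>)))"
    by (rule integral_continuous_on_param) (auto intro!: continuous_intros simp: split_beta)
  then show ?thesis by (simp add: bessel_P_def continuous_on_eq_continuous_at)
qed

lemma isCont_bessel_Q: "isCont (\<lambda>\<nu>. bessel_Q \<nu> z) \<nu>"
proof -
  have "continuous_on UNIV (\<lambda>\<nu>. integral (cbox 0 pi) (\<lambda>\<theta>. sin (z * sin \<theta> - \<nu> * \<theta>)))"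
    by (rule integral_continuous_on_param) (auto intro!: continuous_intros simp: split_beta)
  then show ?thesis by (simp add: bessel_Q_def continuous_on_eq_continuous_at)
qed

lemma isCont_bessel_E:
  assumes "z > 0"
  shows "isCont (\<lambda>\<nu>. bessel_E \<nu> z) \<nu>"
  unfolding continuous_at_sequentially
proof (intro allI impI)
  fix x :: "nat \<Rightarrow> real" assume x: "x \<longlonglongrightarrow> \<nu>"
  \<comment> \<open>Convergent orders are bounded; since s \<ge> 0, the integrand of order -B
    dominates all of them.\<close>
  then obtain B where B: "\<And>n. \<bar>x n\<bar> \<le> B"
    using convergent_imp_Bseq[of x] unfolding convergent_def Bseq_def by auto
  have "(\<lambda>n. bessel_E (x n) z) \<longlonglongrightarrow> bessel_E \<nu> z"
    unfolding bessel_E_def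
  proof (rule dominated_convergence(2))
    show "(\<lambda>s. exp (- (x n * s) - z * sinh s)) integrable_on {0..}" for n
      by (rule bessel_E_integrable[OF assms])
    show "(\<lambda>s. exp (- (- B * s) - z * sinh s)) integrable_on {0..}"
      by (rule bessel_E_integrable[OF assms])
    show "norm (exp (- (x n * s) - z * sinh s)) \<le> exp (- (- B * s) - z * sinh s)" if "s \<in> {0..}" for n s
    proof -
      have "- x n * s \<le> B * s" using that B[of n] by (intro mult_right_mono) auto
      then show ?thesis by simp
    qed
    show "(\<lambda>n. exp (- (x n * s) - z * sinh s)) \<longlonglongrightarrow> exp (- (\<nu> * s) - z * sinh s)" for s
      by (intro tendsto_intros x)
  qed
  then show "((\<lambda>\<nu>. bessel_E \<nu> z) \<circ> x) \<longlonglongrightarrow> bessel_E \<nu> z" by (simp add: o_def)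
qed

lemma isCont_bessel_E_minus:
  assumes "z > 0"
  shows "isCont (\<lambda>\<nu>. bessel_E (- \<nu>) z) \<nu>"
  using isCont_o2[of \<nu> uminus "\<lambda>\<nu>. bessel_E \<nu> z"] isCont_bessel_E[OF assms] by simp

lemma eventually_at_not_Ints: "\<forall>\<^sub>F \<mu> in at (\<nu>::real). \<mu> \<notin> \<int>"
proof -
  have "\<not> \<nu> islimpt \<int>"
    by (rule discrete_imp_not_islimpt[of 1]) (auto simp: Ints_def dist_real_def simp flip: of_int_diff of_int_abs)
  then show ?thesis by (simp add: islimpt_iff_eventually)
qed

lemma bessel_Y_schlaefli:
  assumes "z > 0"
  shows "bessel_Y \<nu> z = (bessel_Q \<nu> z - bessel_E (- \<nu>) z - cos (\<nu> * pi) * bessel_E \<nu> z) / pi"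
proof (cases "\<nu> \<in> \<int>")
  case True
  define F where "F = (\<lambda>\<nu>. (bessel_Q \<nu> z - bessel_E (- \<nu>) z - cos (\<nu> * pi) * bessel_E \<nu> z) / pi)"
  have "isCont F \<nu>"
    unfolding F_def
    by (intro continuous_intros isCont_bessel_Q isCont_bessel_E[OF assms]
        isCont_bessel_E_minus[OF assms]) auto
  then have "(F \<longlongrightarrow> F \<nu>) (at \<nu>)" by (simp add: isCont_def)
  moreover have "\<forall>\<^sub>F \<mu> in at \<nu>. F \<mu> = bessel_Y_quotient \<mu> z"
    using eventually_at_not_Ints[of \<nu>]
    by eventually_elim (simp add: F_def bessel_Y_quotient_schlaefli[OF assms])
  ultimately have "((\<lambda>\<mu>. bessel_Y_quotient \<mu> z) \<longlongrightarrow> F \<nu>) (at \<nu>)"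
    by (rule Lim_transform_eventually)
  then have "Lim (at \<nu>) (\<lambda>\<mu>. bessel_Y_quotient \<mu> z) = F \<nu>"
    by (intro tendsto_Lim) auto
  then show ?thesis using True by (simp add: bessel_Y_def F_def)
next
  case False
  then show ?thesis by (simp add: bessel_Y_def bessel_Y_quotient_schlaefli[OF assms])
qed

lemma isCont_bessel_J:
  assumes "z > 0"
  shows "isCont (\<lambda>\<nu>. bessel_J \<nu> z) \<nu>"
  unfolding bessel_J_schlaefli[OF assms]
  by (intro continuous_intros isCont_bessel_P isCont_bessel_E[OF assms]) auto

lemma isCont_bessel_Y: 
  assumes "z > 0"
  shows "isCont (\<lambda>\<nu>. bessel_Y \<nu> z) \<nu>"
  unfolding bessel_Y_schlaefli[OF assms]
  by (intro continuous_intros isCont_bessel_Q isCont_bessel_E[OF assms]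
        isCont_bessel_E_minus[OF assms]) auto

subsection \<open>Cross products and integrals for the Hankel function\<close>

text \<open>\<open>J(\<mu>, z) = (z/2)^\<mu> g(\<mu>, z^2/4)\<close> with \<open>g\<close> entire; in terms of \<open>g\<close> the cross product has derivative zero.\<close>

definition bessel_coeff :: "real \<Rightarrow> nat \<Rightarrow> real" where
  "bessel_coeff \<mu> k = (- 1) ^ k * rGamma (\<mu> + real k + 1) / fact k"

definition bessel_g :: "real \<Rightarrow> real \<Rightarrow> real" where
  "bessel_g \<mu> s = (\<Sum>k. bessel_coeff \<mu> k * s ^ k)"

lemma bessel_J_eq_g:
  assumes "z > 0"
  shows "bessel_J \<mu> z = (z / 2) powr \<mu> * bessel_g \<mu> ((z / 2)\<^sup>2)"
    and "summable (\<lambda>k. bessel_coeff \<mu> k * ((z / 2)\<^sup>2) ^ k)"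
proof -
  define r where "r = z / 2"
  have r: "r > 0" using assms by (simp add: r_def)
  have eq: "(- 1) ^ k * rGamma (\<mu> + real k + 1) / fact k * r powr (\<mu> + 2 * real k) =
      r powr \<mu> * (bessel_coeff \<mu> k * (r\<^sup>2) ^ k)" for k
    using r powr_realpow[OF r, of "2 * k"]
    by (simp add: bessel_coeff_def powr_add flip: power_mult)
  have s: "summable (\<lambda>k. r powr \<mu> * (bessel_coeff \<mu> k * (r\<^sup>2) ^ k))"
    using sums_summable[OF bessel_J_sums[OF assms, of \<mu>]] by (simp only: r_def[symmetric] eq)
  then show s': "summable (\<lambda>k. bessel_coeff \<mu> k * ((z / 2)\<^sup>2) ^ k)"
    using r by (simp add: r_def summable_cmult_iff)
  show "bessel_J \<mu> z = (z / 2) powr \<mu> * bessel_g \<mu> ((z / 2)\<^sup>2)"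
    using suminf_mult[OF s', of "r powr \<mu>"]
    by (simp only: bessel_J_def bessel_g_def r_def[symmetric] eq)
qed

text \<open>Convergence at the points (z/2)^2 is already known from the integral formula for J; z =
  2(|s|+1) puts s strictly inside such a radius.\<close>

lemma bessel_coeff_summable: "summable (\<lambda>k. bessel_coeff \<mu> k * s ^ k)"
proof (rule powser_inside)
  show "summable (\<lambda>k. bessel_coeff \<mu> k * (((2 * (\<bar>s\<bar> + 1)) / 2)\<^sup>2) ^ k)"
    by (rule bessel_J_eq_g(2)) auto
  then show "norm s < norm (((2 * (\<bar>s\<bar> + 1)) / 2)\<^sup>2)"
    by (auto simp add: power2_eq_square algebra_simps intro!: add_pos_nonneg)
qed

lemma diffs_bessel_coeff: "diffs (bessel_coeff \<mu>) k = - bessel_coeff (\<mu> + 1) k"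
  by (simp add: diffs_def bessel_coeff_def add_ac del: of_nat_Suc) (simp add: field_simps)

lemma bessel_g_deriv: "(bessel_g \<mu> has_real_derivative - bessel_g (\<mu> + 1) s) (at s)"
proof -
  have "((\<lambda>s. \<Sum>k. bessel_coeff \<mu> k * s ^ k) has_real_derivative (\<Sum>k. diffs (bessel_coeff \<mu>) k * s ^ k)) (at s)"
    by (intro termdiffs_strong_converges_everywhere bessel_coeff_summable)
  moreover have "(\<Sum>k. diffs (bessel_coeff \<mu>) k * s ^ k) = - bessel_g (\<mu> + 1) s"
    using suminf_minus[OF bessel_coeff_summable[of "\<mu> + 1" s]] by (simp add: diffs_bessel_coeff bessel_g_def)
  moreover have "bessel_g \<mu> = (\<lambda>s. \<Sum>k. bessel_coeff \<mu> k * s ^ k)" by (simp add: bessel_g_def fun_eq_iff)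
  ultimately show ?thesis by simp
qed

text \<open>Comparison of coefficients: s times the derivative multiplies the k-th coefficient by k,
  and (\<mu>+k)/\<Gamma>(\<mu>+k+1) = 1/\<Gamma>(\<mu>+k).\<close>

lemma bessel_g_recurrence: "s * bessel_g (\<mu> + 1) s = \<mu> * bessel_g \<mu> s - bessel_g (\<mu> - 1) s"
proof -
  have "(\<lambda>k. of_nat k * bessel_coeff \<mu> k * s ^ (k - Suc 0)) sums (\<Sum>k. diffs (bessel_coeff \<mu>) k * s ^ k)"
    using summable_minus[OF bessel_coeff_summable[of "\<mu> + 1" s]]
    by (intro diffs_equiv) (simp add: diffs_bessel_coeff)
  moreover have "(\<Sum>k. diffs (bessel_coeff \<mu>) k * s ^ k) = - bessel_g (\<mu> + 1) s"
    using suminf_minus[OF bessel_coeff_summable[of "\<mu> + 1" s]] by (simp add: diffs_bessel_coeff bessel_g_def)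
  ultimately have "(\<lambda>k. s * (real k * bessel_coeff \<mu> k * s ^ (k - Suc 0))) sums (s * - bessel_g (\<mu> + 1) s)"
    by (intro sums_mult) simp
  moreover have "s * (real k * bessel_coeff \<mu> k * s ^ (k - Suc 0)) = real k * bessel_coeff \<mu> k * s ^ k" for k
    by (cases k) auto
  ultimately have "(\<lambda>k. real k * bessel_coeff \<mu> k * s ^ k) sums (s * - bessel_g (\<mu> + 1) s)"
    by simp
  moreover have "(\<lambda>k. \<mu> * (bessel_coeff \<mu> k * s ^ k)) sums (\<mu> * bessel_g \<mu> s)"
    unfolding bessel_g_def by (intro sums_mult summable_sums bessel_coeff_summable)
  ultimately have "(\<lambda>k. \<mu> * (bessel_coeff \<mu> k * s ^ k) + real k * bessel_coeff \<mu> k * s ^ k) sums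
      (\<mu> * bessel_g \<mu> s + s * - bessel_g (\<mu> + 1) s)"
    by (intro sums_add)
  moreover have "\<mu> * (bessel_coeff \<mu> k * s ^ k) + real k * bessel_coeff \<mu> k * s ^ k = bessel_coeff (\<mu> - 1) k * s ^ k" for k
  proof -
    have "bessel_coeff (\<mu> - 1) k = (\<mu> + real k) * bessel_coeff \<mu> k"
      using rGamma_plus1[of "\<mu> + real k"] by (simp add: bessel_coeff_def)
    then show ?thesis by (simp add: algebra_simps)
  qed
  ultimately have "bessel_g (\<mu> - 1) s = \<mu> * bessel_g \<mu> s + s * - bessel_g (\<mu> + 1) s"
    unfolding bessel_g_def[of "\<mu> - 1"] by (simp add: sums_iff)
  then show ?thesis by simp
qed

text \<open>The recurrences at orders \<nu>+1 and -\<nu> make the derivative vanish. Passing from J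
  to the entire g allows evaluation at s = 0, where the first product disappears and the second is
  an instance of the reflection formula.\<close>

lemma bessel_g_cross:
  "s * bessel_g (\<nu> + 1) s * bessel_g (- \<nu>) s + bessel_g \<nu> s * bessel_g (- \<nu> - 1) s = - sin (\<nu> * pi) / pi"
proof -
  define G where "G = (\<lambda>s. s * bessel_g (\<nu> + 1) s * bessel_g (- \<nu>) s + bessel_g \<nu> s * bessel_g (- \<nu> - 1) s)"
  have "(G has_real_derivative 0) (at s)" for s
  proof -
    define a b c d e f where "a = bessel_g \<nu> s" and "b = bessel_g (\<nu> + 1) s" and "c = bessel_g (\<nu> + 2) s"
      and "d = bessel_g (- \<nu> - 1) s" and "e = bessel_g (- \<nu>) s" and "f = bessel_g (- \<nu> + 1) s"
    have dG: "(G has_real_derivative ((1 * b + s * - c) * e + s * b * - f + (- b * d + a * - e))) (at s)"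
      unfolding G_def
      by (rule derivative_eq_intros bessel_g_deriv refl)+
        (simp add: a_def b_def c_def d_def e_def f_def add_ac mult_ac)
    have "s * c = (\<nu> + 1) * b - a"
      using bessel_g_recurrence[of s "\<nu> + 1"] by (simp add: a_def b_def c_def add_ac)
    moreover have "s * f = - \<nu> * e - d"
      using bessel_g_recurrence[of s "- \<nu>"] by (simp add: d_def e_def f_def add_ac)
    ultimately have "(1 * b + s * - c) * e + s * b * - f + (- b * d + a * - e) = 0"
      by algebra
    then show ?thesis using dG by simp
  qed
  then have "G s = G 0" using DERIV_isconst_all by blast
  also have "bessel_g \<mu> 0 = rGamma (\<mu> + 1)" for \<mu>
    by (simp only: bessel_g_def powser_zero) (simp add: bessel_coeff_def)
  then have "G 0 = rGamma (- \<nu>) * rGamma (1 - (- \<nu>))" by (simp add: G_def add.commute mult.commute)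
  also have "\<dots> = - sin (\<nu> * pi) / pi" by (simp only: rGamma_reflection_real) simp
  finally show ?thesis by (simp add: G_def)
qed

lemma bessel_J_cross:
  assumes "z > 0"
  shows "bessel_J (\<nu> + 1) z * bessel_J (- \<nu>) z + bessel_J \<nu> z * bessel_J (- \<nu> - 1) z =
    - 2 * sin (\<nu> * pi) / (pi * z)"
proof -
  define r where "r = z / 2"
  have r: "r > 0" using assms by (simp add: r_def)
  have "bessel_J (\<nu> + 1) z * bessel_J (- \<nu>) z = (r powr (\<nu> + 1) * r powr (- \<nu>)) * bessel_g (\<nu> + 1) (r\<^sup>2) * bessel_g (- \<nu>) (r\<^sup>2)"
    by (simp add: bessel_J_eq_g[OF assms] r_def)
  also have "r powr (\<nu> + 1) * r powr (- \<nu>) = r" using r by (simp flip: powr_add)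
  finally have 1: "bessel_J (\<nu> + 1) z * bessel_J (- \<nu>) z = r * bessel_g (\<nu> + 1) (r\<^sup>2) * bessel_g (- \<nu>) (r\<^sup>2)" .
  have "bessel_J \<nu> z * bessel_J (- \<nu> - 1) z = (r powr \<nu> * r powr (- \<nu> - 1)) * bessel_g \<nu> (r\<^sup>2) * bessel_g (- \<nu> - 1) (r\<^sup>2)"
    by (simp add: bessel_J_eq_g[OF assms] r_def)
  also have "r powr \<nu> * r powr (- \<nu> - 1) = 1 / r" using r by (simp add: powr_minus_divide flip: powr_add)
  finally have 2: "bessel_J \<nu> z * bessel_J (- \<nu> - 1) z = 1 / r * bessel_g \<nu> (r\<^sup>2) * bessel_g (- \<nu> - 1) (r\<^sup>2)" .
  have "bessel_J (\<nu> + 1) z * bessel_J (- \<nu>) z + bessel_J \<nu> z * bessel_J (- \<nu> - 1) z =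
     (r\<^sup>2 * bessel_g (\<nu> + 1) (r\<^sup>2) * bessel_g (- \<nu>) (r\<^sup>2) + bessel_g \<nu> (r\<^sup>2) * bessel_g (- \<nu> - 1) (r\<^sup>2)) / r"
    unfolding 1 2 using r by (simp add: field_simps power2_eq_square)
  also have "\<dots> = - sin (\<nu> * pi) / pi / r" by (simp only: bessel_g_cross)
  finally show ?thesis by (simp add: r_def field_simps)
qed

text \<open>At non-integer order the two cosine contributions J(\<nu>) J(\<nu>+1) cancel, because
  sine and cosine both change sign from \<nu> to \<nu>+1; what remains is the cross product of J
  divided by sin(\<nu>\<pi>). Integer orders follow by continuity.\<close>

lemma bessel_cross_product:
  assumes "z > 0"
  shows "bessel_J (\<nu> + 1) z * bessel_Y \<nu> z - bessel_J \<nu> z * bessel_Y (\<nu> + 1) z = 2 / (pi * z)"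
proof -
  define c where "c = (\<lambda>\<nu>. bessel_J (\<nu> + 1) z * bessel_Y \<nu> z - bessel_J \<nu> z * bessel_Y (\<nu> + 1) z)"
  have cn: "c \<mu> = 2 / (pi * z)" if "\<mu> \<notin> \<int>" for \<mu>
  proof -
    have s: "sin (\<mu> * pi) \<noteq> 0" using that by (simp add: sin_times_pi_eq_0)
    have "\<mu> + 1 \<notin> \<int>" using that by (metis Ints_1 Ints_diff add_diff_cancel_right')
    then have "c \<mu> = - (bessel_J (\<mu> + 1) z * bessel_J (- \<mu>) z + bessel_J \<mu> z * bessel_J (- \<mu> - 1) z) / sin (\<mu> * pi)"
      using that s by (simp add: c_def bessel_Y_def bessel_Y_quotient_def distrib_right sin_add cos_add)
        (simp add: field_simps)
    then show ?thesis using s by (simp add: bessel_J_cross[OF assms])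
  qed
  have "isCont c \<nu>"
    unfolding c_def
    by (intro continuous_intros isCont_bessel_J[OF assms] isCont_bessel_Y[OF assms]
        isCont_o2[of \<nu> "\<lambda>\<nu>. \<nu> + 1" "\<lambda>\<nu>. bessel_J \<nu> z"]
        isCont_o2[of \<nu> "\<lambda>\<nu>. \<nu> + 1" "\<lambda>\<nu>. bessel_Y \<nu> z"])
  then have "(c \<longlongrightarrow> c \<nu>) (at \<nu>)" by (simp add: isCont_def)
  moreover have "(c \<longlongrightarrow> 2 / (pi * z)) (at \<nu>)"
    using eventually_at_not_Ints[of \<nu>] by (intro tendsto_eventually) (auto elim!: eventually_mono simp: cn)
  ultimately have "c \<nu> = 2 / (pi * z)" using LIM_unique by blast
  then show ?thesis by (simp add: c_def)
qed

text \<open>The imaginary part of conj(H(\<nu>)) (H(\<nu>-1) - H(\<nu>+1)) is the sum of the cross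
  products at orders \<nu> and \<nu>-1, each equal to 2/(\<pi>z).\<close>

lemma hankel_lower_from_difference:
  assumes "z > 0"
  shows "4 / (pi * z) \<le> cmod (hankel_H1 \<nu> z) * cmod (hankel_H1 (\<nu> - 1) z - hankel_H1 (\<nu> + 1) z)"
proof -
  define W where "W = cnj (hankel_H1 \<nu> z) * (hankel_H1 (\<nu> - 1) z - hankel_H1 (\<nu> + 1) z)"
  have "Im W = (bessel_J (\<nu> + 1) z * bessel_Y \<nu> z - bessel_J \<nu> z * bessel_Y (\<nu> + 1) z) +
      (bessel_J (\<nu> - 1 + 1) z * bessel_Y (\<nu> - 1) z - bessel_J (\<nu> - 1) z * bessel_Y (\<nu> - 1 + 1) z)"
    by (simp add: W_def hankel_H1_def algebra_simps)
  also have "\<dots> = 4 / (pi * z)" by (simp only: bessel_cross_product[OF assms])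
  finally have "4 / (pi * z) \<le> \<bar>Im W\<bar>" by linarith
  also have "\<dots> \<le> cmod W" by (rule abs_Im_le_cmod)
  finally show ?thesis by (simp add: W_def norm_mult)
qed

section \<open>Estimates of H and of its order differences by the integrals\<close>

lemma bessel_E_nonneg: "z > 0 \<Longrightarrow> bessel_E \<nu> z \<ge> 0"
  unfolding bessel_E_def by (intro integral_nonneg bessel_E_integrable) auto

lemma bessel_E_antimono:
  assumes "z > 0" "\<mu> \<le> \<nu>"
  shows "bessel_E \<nu> z \<le> bessel_E \<mu> z"
  unfolding bessel_E_def
  by (intro integral_le bessel_E_integrable assms) (use assms in \<open>auto intro: mult_right_mono\<close>)

text \<open>J contributes E(\<nu>) once, Y contributes E(\<nu>) and E(-\<nu>) once each;
  monotonicity in the order replaces all three by E(-\<nu>).\<close>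

lemma hankel_upper:
  assumes "z > 0" "\<nu> \<ge> 0"
  shows "pi * cmod (hankel_H1 \<nu> z) \<le> \<bar>bessel_P \<nu> z\<bar> + \<bar>bessel_Q \<nu> z\<bar> + 3 * bessel_E (- \<nu>) z"
proof -
  have E: "0 \<le> bessel_E \<nu> z" "bessel_E \<nu> z \<le> bessel_E (- \<nu>) z"
    using bessel_E_nonneg bessel_E_antimono assms by auto
  have "\<bar>sin (\<nu> * pi) * bessel_E \<nu> z\<bar> \<le> 1 * bessel_E \<nu> z" "\<bar>cos (\<nu> * pi) * bessel_E \<nu> z\<bar> \<le> 1 * bessel_E \<nu> z"
    unfolding abs_mult using E by (intro mult_mono; simp)+
  then have "pi * \<bar>bessel_J \<nu> z\<bar> \<le> \<bar>bessel_P \<nu> z\<bar> + bessel_E \<nu> z"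
    and "pi * \<bar>bessel_Y \<nu> z\<bar> \<le> \<bar>bessel_Q \<nu> z\<bar> + bessel_E (- \<nu>) z + bessel_E \<nu> z"
    using E by (auto simp: bessel_J_schlaefli bessel_Y_schlaefli assms abs_divide)
  moreover have "cmod (hankel_H1 \<nu> z) \<le> \<bar>bessel_J \<nu> z\<bar> + \<bar>bessel_Y \<nu> z\<bar>"
    using cmod_le[of "hankel_H1 \<nu> z"] by (simp add: hankel_H1_def)
  then have "pi * cmod (hankel_H1 \<nu> z) \<le> pi * \<bar>bessel_J \<nu> z\<bar> + pi * \<bar>bessel_Y \<nu> z\<bar>"
    by (simp flip: distrib_left)
  ultimately show ?thesis using E by linarith
qed

text \<open>Y alone suffices, since the large term E(-\<nu>) occurs only there. Intended for the
  exponential regime.\<close>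

lemma hankel_lower:
  assumes "z > 0"
  shows "bessel_E (- \<nu>) z - bessel_E \<nu> z - \<bar>bessel_Q \<nu> z\<bar> \<le> pi * cmod (hankel_H1 \<nu> z)"
proof -
  have "\<bar>cos (\<nu> * pi) * bessel_E \<nu> z\<bar> \<le> 1 * bessel_E \<nu> z"
    unfolding abs_mult using bessel_E_nonneg[OF assms] by (intro mult_mono) auto
  then have "bessel_E (- \<nu>) z - bessel_E \<nu> z - \<bar>bessel_Q \<nu> z\<bar> \<le> pi * \<bar>bessel_Y \<nu> z\<bar>"
    by (auto simp: bessel_Y_schlaefli assms abs_divide)
  also have "\<dots> \<le> pi * cmod (hankel_H1 \<nu> z)"
    using abs_Im_le_cmod[of "hankel_H1 \<nu> z"] by (simp add: hankel_H1_def)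
  finally show ?thesis .
qed

text \<open>Formally -dE/dz, just as H(\<nu>-1) - H(\<nu>+1) is 2 dH/dz. Using order differences
  avoids differentiation under the integral sign.\<close>

definition bessel_E1 :: "real \<Rightarrow> real \<Rightarrow> real" where
  "bessel_E1 \<nu> z = integral {0..} (\<lambda>s. sinh s * exp (- (\<nu> * s) - z * sinh s))"

lemma bessel_E1_has_integral:
  assumes "z > 0"
  shows "((\<lambda>s. sinh s * exp (- (\<nu> * s) - z * sinh s)) has_integral ((bessel_E (\<nu> - 1) z - bessel_E (\<nu> + 1) z) / 2)) {0..}"
proof -
  have "((\<lambda>s. (exp (- ((\<nu> - 1) * s) - z * sinh s) - exp (- ((\<nu> + 1) * s) - z * sinh s)) / 2) has_integral
      ((bessel_E (\<nu> - 1) z - bessel_E (\<nu> + 1) z) / 2)) {0..}"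
    unfolding bessel_E_def
    by (intro has_integral_divide has_integral_diff integrable_integral bessel_E_integrable assms)
  moreover have "(exp (- ((\<nu> - 1) * s) - z * sinh s) - exp (- ((\<nu> + 1) * s) - z * sinh s)) / 2 =
      sinh s * exp (- (\<nu> * s) - z * sinh s)" for s
  proof -
    have "- ((\<nu> - 1) * s) - z * sinh s = s + (- (\<nu> * s) - z * sinh s)"
      "- ((\<nu> + 1) * s) - z * sinh s = - s + (- (\<nu> * s) - z * sinh s)" by (simp_all add: algebra_simps)
    then show ?thesis by (simp only: exp_add sinh_field_def) (simp add: algebra_simps)
  qed
  ultimately show ?thesis by simp
qed

lemma bessel_E1_eq: "z > 0 \<Longrightarrow> bessel_E (\<nu> - 1) z - bessel_E (\<nu> + 1) z = 2 * bessel_E1 \<nu> z"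
  using integral_unique[OF bessel_E1_has_integral, of z \<nu>] by (simp add: bessel_E1_def)

lemma bessel_E1_nonneg: "z > 0 \<Longrightarrow> bessel_E1 \<nu> z \<ge> 0"
  unfolding bessel_E1_def by (intro integral_nonneg has_integral_integrable[OF bessel_E1_has_integral]) auto

lemma bessel_E1_antimono:
  assumes "z > 0" "\<mu> \<le> \<nu>"
  shows "bessel_E1 \<nu> z \<le> bessel_E1 \<mu> z"
  unfolding bessel_E1_def
  by (intro integral_le has_integral_integrable[OF bessel_E1_has_integral] mult_left_mono)
    (use assms in \<open>auto intro: mult_right_mono\<close>)

definition bessel_P1 :: "real \<Rightarrow> real \<Rightarrow> real" where
  "bessel_P1 \<nu> z = integral {0..pi} (\<lambda>\<theta>. sin \<theta> * cos (z * sin \<theta> - \<nu> * \<theta>))"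

definition bessel_Q1 :: "real \<Rightarrow> real \<Rightarrow> real" where
  "bessel_Q1 \<nu> z = integral {0..pi} (\<lambda>\<theta>. sin \<theta> * sin (z * sin \<theta> - \<nu> * \<theta>))"

lemma bessel_P_diff: "bessel_P (\<nu> - 1) z - bessel_P (\<nu> + 1) z = - 2 * bessel_Q1 \<nu> z"
proof -
  have "bessel_P (\<nu> - 1) z - bessel_P (\<nu> + 1) z =
      integral {0..pi} (\<lambda>\<theta>. cos (z * sin \<theta> - (\<nu> - 1) * \<theta>) - cos (z * sin \<theta> - (\<nu> + 1) * \<theta>))"
    unfolding bessel_P_def
    by (intro integral_diff[symmetric] integrable_continuous_interval continuous_intros)
  also have "(\<lambda>\<theta>. cos (z * sin \<theta> - (\<nu> - 1) * \<theta>) - cos (z * sin \<theta> - (\<nu> + 1) * \<theta>)) =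
      (\<lambda>\<theta>. - 2 * (sin \<theta> * sin (z * sin \<theta> - \<nu> * \<theta>)))"
  proof
    fix \<theta>
    have "z * sin \<theta> - (\<nu> - 1) * \<theta> = (z * sin \<theta> - \<nu> * \<theta>) + \<theta>"
      "z * sin \<theta> - (\<nu> + 1) * \<theta> = (z * sin \<theta> - \<nu> * \<theta>) - \<theta>" by (simp_all add: algebra_simps)
    then show "cos (z * sin \<theta> - (\<nu> - 1) * \<theta>) - cos (z * sin \<theta> - (\<nu> + 1) * \<theta>) =
        - 2 * (sin \<theta> * sin (z * sin \<theta> - \<nu> * \<theta>))"
      by (simp only: cos_add cos_diff) simp
  qed
  finally show ?thesis by (simp only: bessel_Q1_def integral_mult_right)
qed

lemma bessel_Q_diff: "bessel_Q (\<nu> - 1) z - bessel_Q (\<nu> + 1) z = 2 * bessel_P1 \<nu> z"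
proof -
  have "bessel_Q (\<nu> - 1) z - bessel_Q (\<nu> + 1) z =
      integral {0..pi} (\<lambda>\<theta>. sin (z * sin \<theta> - (\<nu> - 1) * \<theta>) - sin (z * sin \<theta> - (\<nu> + 1) * \<theta>))"
    unfolding bessel_Q_def
    by (intro integral_diff[symmetric] integrable_continuous_interval continuous_intros)
  also have "(\<lambda>\<theta>. sin (z * sin \<theta> - (\<nu> - 1) * \<theta>) - sin (z * sin \<theta> - (\<nu> + 1) * \<theta>)) =
      (\<lambda>\<theta>. 2 * (sin \<theta> * cos (z * sin \<theta> - \<nu> * \<theta>)))"
  proof
    fix \<theta>
    have "z * sin \<theta> - (\<nu> - 1) * \<theta> = (z * sin \<theta> - \<nu> * \<theta>) + \<theta>"
      "z * sin \<theta> - (\<nu> + 1) * \<theta> = (z * sin \<theta> - \<nu> * \<theta>) - \<theta>" by (simp_all add: algebra_simps)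
    then show "sin (z * sin \<theta> - (\<nu> - 1) * \<theta>) - sin (z * sin \<theta> - (\<nu> + 1) * \<theta>) =
        2 * (sin \<theta> * cos (z * sin \<theta> - \<nu> * \<theta>))"
      by (simp only: sin_add sin_diff) simp
  qed
  finally show ?thesis by (simp only: bessel_P1_def integral_mult_right)
qed

lemma hankel_difference_upper:
  assumes "z > 0" "\<nu> \<ge> 0"
  shows "pi * cmod (hankel_H1 (\<nu> - 1) z - hankel_H1 (\<nu> + 1) z) \<le>
    2 * (\<bar>bessel_P1 \<nu> z\<bar> + \<bar>bessel_Q1 \<nu> z\<bar> + 3 * bessel_E1 (- \<nu>) z)"
proof -
  define D where "D = hankel_H1 (\<nu> - 1) z - hankel_H1 (\<nu> + 1) z"
  have E: "0 \<le> bessel_E1 \<nu> z" "bessel_E1 \<nu> z \<le> bessel_E1 (- \<nu>) z"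
    using bessel_E1_nonneg bessel_E1_antimono assms by auto
  have "\<bar>sin (\<nu> * pi) * bessel_E1 \<nu> z\<bar> \<le> 1 * bessel_E1 \<nu> z" "\<bar>cos (\<nu> * pi) * bessel_E1 \<nu> z\<bar> \<le> 1 * bessel_E1 \<nu> z"
    unfolding abs_mult using E by (intro mult_mono; simp)+
  \<comment> \<open>The orders \<nu>-1 and \<nu>+1 differ by 2, so their trigonometric factors
    coincide (both are minus the one at \<nu>), and the E terms combine into a difference.\<close>
  moreover have "pi * Re D = - 2 * bessel_Q1 \<nu> z + sin (\<nu> * pi) * (bessel_E (\<nu> - 1) z - bessel_E (\<nu> + 1) z)"
    unfolding bessel_P_diff[symmetric]
    by (simp add: D_def hankel_H1_def bessel_J_schlaefli assms left_diff_distrib distrib_right sin_diff sin_add field_simps)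
  then have "pi * Re D = - 2 * bessel_Q1 \<nu> z + 2 * (sin (\<nu> * pi) * bessel_E1 \<nu> z)"
    by (simp add: bessel_E1_eq assms)
  moreover have "pi * Im D = 2 * bessel_P1 \<nu> z + (bessel_E (- \<nu> - 1) z - bessel_E (- \<nu> + 1) z)
      + cos (\<nu> * pi) * (bessel_E (\<nu> - 1) z - bessel_E (\<nu> + 1) z)"
    unfolding bessel_Q_diff[symmetric]
    by (simp add: D_def hankel_H1_def bessel_Y_schlaefli assms left_diff_distrib distrib_right cos_diff cos_add minus_diff_commute field_simps)
  then have "pi * Im D = 2 * bessel_P1 \<nu> z + 2 * bessel_E1 (- \<nu>) z + 2 * (cos (\<nu> * pi) * bessel_E1 \<nu> z)"
    by (simp only: bessel_E1_eq[OF assms(1)] mult.left_commute)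
  ultimately have "\<bar>pi * Re D\<bar> \<le> 2 * \<bar>bessel_Q1 \<nu> z\<bar> + 2 * bessel_E1 \<nu> z"
    and "\<bar>pi * Im D\<bar> \<le> 2 * \<bar>bessel_P1 \<nu> z\<bar> + 2 * bessel_E1 (- \<nu>) z + 2 * bessel_E1 \<nu> z"
    using E by (auto simp only: abs_le_iff; linarith)+
  moreover have "a + b \<le> 2 * (p + q + 3 * e')"
    if "a \<le> 2 * q + 2 * e" "b \<le> 2 * p + 2 * e' + 2 * e" "e \<le> e'" for a b p q e e' :: real
    using that by argo
  ultimately have "\<bar>pi * Re D\<bar> + \<bar>pi * Im D\<bar> \<le> 2 * (\<bar>bessel_P1 \<nu> z\<bar> + \<bar>bessel_Q1 \<nu> z\<bar> + 3 * bessel_E1 (- \<nu>) z)"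
    using E(2) by blast
  moreover have "pi * cmod D \<le> \<bar>pi * Re D\<bar> + \<bar>pi * Im D\<bar>"
    using mult_left_mono[OF cmod_le[of D], of pi] by (simp add: abs_mult distrib_left)
  ultimately show ?thesis by (simp add: D_def)
qed

subsection \<open>The oscillatory region\<close>

text \<open>Since \<open>(h sin \<phi>)' = h' sin \<phi> + h \<phi>' cos \<phi>\<close>, monotonicity of \<open>h\<close> bounds the error term \<open>\<integral> h' sin \<phi>\<close>
  by the total variation of \<open>h\<close>.\<close>

lemma van_der_corput:
  fixes \<phi> \<phi>' h h' :: "real \<Rightarrow> real"
  assumes "\<alpha> \<le> \<beta>"
    and h: "\<And>x. x \<in> {\<alpha>..\<beta>} \<Longrightarrow> (h has_real_derivative h' x) (at x within {\<alpha>..\<beta>})"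
    and \<phi>: "\<And>x. x \<in> {\<alpha>..\<beta>} \<Longrightarrow> (\<phi> has_real_derivative \<phi>' x) (at x within {\<alpha>..\<beta>})"
    and cont: "continuous_on {\<alpha>..\<beta>} \<phi>'"
    and mono: "\<And>x. x \<in> {\<alpha>..\<beta>} \<Longrightarrow> h' x \<ge> 0"
  shows "\<bar>integral {\<alpha>..\<beta>} (\<lambda>x. h x * \<phi>' x * cos (\<phi> x))\<bar> \<le> 2 * (\<bar>h \<alpha>\<bar> + \<bar>h \<beta>\<bar>)"
proof -
  let ?f = "\<lambda>x. h x * \<phi>' x * cos (\<phi> x)"
  have "continuous_on {\<alpha>..\<beta>} h" "continuous_on {\<alpha>..\<beta>} \<phi>"
    by (rule DERIV_continuous_on[OF h] DERIV_continuous_on[OF \<phi>]; assumption)+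
  then have i: "(?f has_integral integral {\<alpha>..\<beta>} ?f) {\<alpha>..\<beta>}"
    using cont by (intro integrable_integral integrable_continuous_interval continuous_intros)
  have ftc: "((\<lambda>x. h' x * (sin (\<phi> x) + c) + ?f x) has_integral
      (h \<beta> * (sin (\<phi> \<beta>) + c) - h \<alpha> * (sin (\<phi> \<alpha>) + c))) {\<alpha>..\<beta>}" for c
    using assms(1)
  proof (rule fundamental_theorem_of_calculus)
    fix x assume "x \<in> {\<alpha>..\<beta>}"
    then show "((\<lambda>x. h x * (sin (\<phi> x) + c)) has_vector_derivative h' x * (sin (\<phi> x) + c) + ?f x)
        (at x within {\<alpha>..\<beta>})"
      unfolding has_real_derivative_iff_has_vector_derivative[symmetric]
      by (auto intro!: derivative_eq_intros h \<phi> simp: algebra_simps)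
  qed
  have b: "\<bar>h \<gamma> * (sin (\<phi> \<gamma>) + c)\<bar> \<le> \<bar>h \<gamma>\<bar> * 2" if "\<bar>c\<bar> = 1" for c \<gamma>
    unfolding abs_mult using abs_sin_le_one[of "\<phi> \<gamma>"] that
    by (intro mult_left_mono order_trans[OF abs_triangle_ineq]) auto
  have s: "sin (\<phi> x) + 1 \<ge> 0" "sin (\<phi> x) + - 1 \<le> 0" for x
    using sin_ge_minus_one[of "\<phi> x"] sin_le_one[of "\<phi> x"] by linarith+
  have "integral {\<alpha>..\<beta>} ?f \<le> h \<beta> * (sin (\<phi> \<beta>) + 1) - h \<alpha> * (sin (\<phi> \<alpha>) + 1)"
    by (rule has_integral_le[OF i ftc[of 1]]) (use mono s in auto)
  moreover have "integral {\<alpha>..\<beta>} ?f \<ge> h \<beta> * (sin (\<phi> \<beta>) + - 1) - h \<alpha> * (sin (\<phi> \<alpha>) + - 1)"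
    by (rule has_integral_le[OF ftc[of "- 1"] i]) (use mono s in \<open>auto simp: mult_le_0_iff\<close>)
  ultimately show ?thesis
    using b[of 1 \<alpha>] b[of 1 \<beta>] b[of "- 1" \<alpha>] b[of "- 1" \<beta>] unfolding abs_le_iff by auto
qed

text \<open>Take h = 1/\<phi>', which increases because the cosine decreases on [0, \<pi>]. The free
  phase c covers cosine and sine integrals at once.\<close>

lemma oscillatory_bound_1:
  assumes "0 \<le> \<alpha>" "\<alpha> \<le> \<beta>" "\<beta> \<le> pi" "z > 0"
    and nz: "\<And>\<theta>. \<theta> \<in> {\<alpha>..\<beta>} \<Longrightarrow> z * cos \<theta> - \<nu> \<noteq> 0"
  shows "\<bar>integral {\<alpha>..\<beta>} (\<lambda>\<theta>. cos (z * sin \<theta> - \<nu> * \<theta> + c))\<bar> \<le>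
    2 * (1 / \<bar>z * cos \<alpha> - \<nu>\<bar> + 1 / \<bar>z * cos \<beta> - \<nu>\<bar>)"
proof -
  have "\<bar>integral {\<alpha>..\<beta>} (\<lambda>\<theta>. 1 / (z * cos \<theta> - \<nu>) * (z * cos \<theta> - \<nu>) * cos (z * sin \<theta> - \<nu> * \<theta> + c))\<bar> \<le>
    2 * (\<bar>1 / (z * cos \<alpha> - \<nu>)\<bar> + \<bar>1 / (z * cos \<beta> - \<nu>)\<bar>)"
  proof (rule van_der_corput)
    fix \<theta> assume \<theta>: "\<theta> \<in> {\<alpha>..\<beta>}"
    show "((\<lambda>\<theta>. 1 / (z * cos \<theta> - \<nu>)) has_real_derivative z * sin \<theta> / (z * cos \<theta> - \<nu>)\<^sup>2) (at \<theta> within {\<alpha>..\<beta>})"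
      using nz[OF \<theta>] by (auto intro!: derivative_eq_intros simp: power2_eq_square)
    show "0 \<le> z * sin \<theta> / (z * cos \<theta> - \<nu>)\<^sup>2" using \<theta> assms by (auto intro!: divide_nonneg_nonneg mult_nonneg_nonneg sin_ge_zero)
  qed (use assms in \<open>auto intro!: derivative_eq_intros continuous_intros\<close>)
  moreover have "integral {\<alpha>..\<beta>} (\<lambda>\<theta>. 1 / (z * cos \<theta> - \<nu>) * (z * cos \<theta> - \<nu>) * cos (z * sin \<theta> - \<nu> * \<theta> + c)) =
      integral {\<alpha>..\<beta>} (\<lambda>\<theta>. cos (z * sin \<theta> - \<nu> * \<theta> + c))"
    using nz by (intro integral_cong) auto
  ultimately show ?thesis by simp
qed

text \<open>Here h = sin \<theta>/\<phi>', and the numerator of h' simplifies to z - \<nu> cos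
  \<theta>; this is the origin of the second sign condition.\<close>

lemma oscillatory_bound_sin:
  assumes "0 \<le> \<alpha>" "\<alpha> \<le> \<beta>" "\<beta> \<le> pi" "z > 0"
    and nz: "\<And>\<theta>. \<theta> \<in> {\<alpha>..\<beta>} \<Longrightarrow> z * cos \<theta> - \<nu> \<noteq> 0"
    and mono: "\<And>\<theta>. \<theta> \<in> {\<alpha>..\<beta>} \<Longrightarrow> \<nu> * cos \<theta> \<le> z"
  shows "\<bar>integral {\<alpha>..\<beta>} (\<lambda>\<theta>. sin \<theta> * cos (z * sin \<theta> - \<nu> * \<theta> + c))\<bar> \<le>
    2 * (sin \<alpha> / \<bar>z * cos \<alpha> - \<nu>\<bar> + sin \<beta> / \<bar>z * cos \<beta> - \<nu>\<bar>)"
proof -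
  have "\<bar>integral {\<alpha>..\<beta>} (\<lambda>\<theta>. sin \<theta> / (z * cos \<theta> - \<nu>) * (z * cos \<theta> - \<nu>) * cos (z * sin \<theta> - \<nu> * \<theta> + c))\<bar> \<le>
    2 * (\<bar>sin \<alpha> / (z * cos \<alpha> - \<nu>)\<bar> + \<bar>sin \<beta> / (z * cos \<beta> - \<nu>)\<bar>)"
  proof (rule van_der_corput)
    fix \<theta> assume \<theta>: "\<theta> \<in> {\<alpha>..\<beta>}"
    have "cos \<theta> * (z * cos \<theta> - \<nu>) - sin \<theta> * (- (z * sin \<theta>)) = z * ((sin \<theta>)\<^sup>2 + (cos \<theta>)\<^sup>2) - \<nu> * cos \<theta>"
      by (simp only: distrib_left right_diff_distrib power2_eq_square) simp
    then have "cos \<theta> * (z * cos \<theta> - \<nu>) - sin \<theta> * (- (z * sin \<theta>)) = z - \<nu> * cos \<theta>" by simp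
    then show "((\<lambda>\<theta>. sin \<theta> / (z * cos \<theta> - \<nu>)) has_real_derivative (z - \<nu> * cos \<theta>) / (z * cos \<theta> - \<nu>)\<^sup>2) (at \<theta> within {\<alpha>..\<beta>})"
      using nz[OF \<theta>] by (auto intro!: derivative_eq_intros simp: power2_eq_square mult_ac)
    show "0 \<le> (z - \<nu> * cos \<theta>) / (z * cos \<theta> - \<nu>)\<^sup>2" using mono[OF \<theta>] by (auto intro!: divide_nonneg_nonneg)
  qed (use assms in \<open>auto intro!: derivative_eq_intros continuous_intros\<close>)
  moreover have "integral {\<alpha>..\<beta>} (\<lambda>\<theta>. sin \<theta> / (z * cos \<theta> - \<nu>) * (z * cos \<theta> - \<nu>) * cos (z * sin \<theta> - \<nu> * \<theta> + c)) =
      integral {\<alpha>..\<beta>} (\<lambda>\<theta>. sin \<theta> * cos (z * sin \<theta> - \<nu> * \<theta> + c))"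
    using nz by (intro integral_cong) auto
  moreover have "sin \<alpha> \<ge> 0" "sin \<beta> \<ge> 0" using assms by (auto intro: sin_ge_zero)
  ultimately show ?thesis by simp
qed

lemma bessel_oscillatory_bounds:
  assumes "\<And>c. \<bar>integral {0..pi} (\<lambda>\<theta>. cos (z * sin \<theta> - \<nu> * \<theta> + c))\<bar> \<le> B"
  shows "\<bar>bessel_P \<nu> z\<bar> \<le> B" "\<bar>bessel_Q \<nu> z\<bar> \<le> B"
  using assms[of 0] assms[of "- (pi / 2)"] by (simp_all add: bessel_P_def bessel_Q_def cos_diff)

lemma bessel_oscillatory_bounds_1:
  assumes "\<And>c. \<bar>integral {0..pi} (\<lambda>\<theta>. sin \<theta> * cos (z * sin \<theta> - \<nu> * \<theta> + c))\<bar> \<le> B"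
  shows "\<bar>bessel_P1 \<nu> z\<bar> \<le> B" "\<bar>bessel_Q1 \<nu> z\<bar> \<le> B"
  using assms[of 0] assms[of "- (pi / 2)"] by (simp_all add: bessel_P1_def bessel_Q1_def cos_diff)

section \<open>Isolating the stationary point\<close>

lemma abs_integral_le_length:
  fixes f :: "real \<Rightarrow> real"
  assumes "continuous_on {a..b} f" "\<And>x. x \<in> {a..b} \<Longrightarrow> \<bar>f x\<bar> \<le> B" "a \<le> b"
  shows "\<bar>integral {a..b} f\<bar> \<le> B * (b - a)"
  using integral_bound[OF assms(3,1)] assms(2) by auto

lemma half_le_sin: 
  assumes "0 \<le> x" "x \<le> (1::real)"
  shows "x / 2 \<le> sin x"
proof -
  have "sin 0 - 0 / 2 \<le> sin x - x / 2"
  proof (rule DERIV_nonneg_imp_nondecreasing[OF assms(1)])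
    fix y assume y: "0 \<le> y" "y \<le> x"
    have "cos (pi / 3) \<le> cos y" using y assms pi_gt3 by (intro cos_monotone_0_pi_le) auto
    then have "cos y - 1 / 2 \<ge> 0" by (simp add: cos_60)
    moreover have "((\<lambda>y. sin y - y / 2) has_real_derivative cos y - 1 / 2) (at y)"
      by (auto intro!: derivative_eq_intros)
    ultimately show "\<exists>d. ((\<lambda>y. sin y - y / 2) has_real_derivative d) (at y) \<and> 0 \<le> d" by blast
  qed
  then show ?thesis by simp
qed

lemma sin_lipschitz: "\<bar>sin x - sin y\<bar> \<le> \<bar>x - y\<bar>" for x y :: real
proof -
  have "\<bar>sin x - sin y\<bar> = 2 * (\<bar>sin ((x - y) / 2)\<bar> * \<bar>cos ((x + y) / 2)\<bar>)"
    by (simp add: sin_diff_sin abs_mult)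
  also have "\<dots> \<le> 2 * (\<bar>(x - y) / 2\<bar> * 1)"
    by (intro mult_left_mono mult_mono abs_sin_x_le_abs_x) auto
  finally show ?thesis by simp
qed

lemma integral_split3:
  fixes f :: "real \<Rightarrow> real"
  assumes "continuous_on {a..d} f" "a \<le> b" "b \<le> c" "c \<le> d"
    "\<bar>integral {a..b} f\<bar> \<le> A" "\<bar>integral {b..c} f\<bar> \<le> B" "\<bar>integral {c..d} f\<bar> \<le> C"
  shows "\<bar>integral {a..d} f\<bar> \<le> A + B + C"
proof -
  have i: "f integrable_on {a..d}" by (intro integrable_continuous_interval assms)
  have "integral {a..b} f + integral {b..d} f = integral {a..d} f"
    using assms i by (intro Henstock_Kurzweil_Integration.integral_combine) auto
  moreover have "integral {b..c} f + integral {c..d} f = integral {b..d} f"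
    using assms by (intro Henstock_Kurzweil_Integration.integral_combine integrable_subinterval_real[OF i]) auto
  ultimately show ?thesis using assms(5-7) by linarith
qed

text \<open>At \<theta>0 = arccos(\<nu>/z) one has z sin \<theta>0 = \<sigma>^2, so the phase varies
  by O(1) within distance \<delta> = 1/(2\<sigma>). There the trivial bound is used; outside,
  |\<phi>'| \<ge> 3\<sigma>/16. The condition z \<le> \<sigma>^3 says exactly 2\<delta> \<le> sin
  \<theta>0: the window keeps away from \<theta> = 0, and the sine is comparable to sin \<theta>0 on
  it. The constants round up 128/3 + 1 and 32 + 3/2.\<close>

lemma oscillatory_region_bounds:
  assumes z: "z > 0" and \<nu>: "0 \<le> \<nu>" "\<nu> \<le> z" and \<sigma>: "\<sigma> > 0" "\<sigma> ^ 4 = z\<^sup>2 - \<nu>\<^sup>2" "z \<le> \<sigma> ^ 3"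
  shows "\<bar>integral {0..pi} (\<lambda>\<theta>. cos (z * sin \<theta> - \<nu> * \<theta> + c))\<bar> \<le> 44 / \<sigma>"
    and "\<bar>integral {0..pi} (\<lambda>\<theta>. sin \<theta> * cos (z * sin \<theta> - \<nu> * \<theta> + c))\<bar> \<le> 34 * \<sigma> / z"
proof -
  define \<theta>0 \<delta> where "\<theta>0 = arccos (\<nu> / z)" and "\<delta> = 1 / (2 * \<sigma>)"
  have u: "0 \<le> \<nu> / z" "\<nu> / z \<le> 1" using z \<nu> by auto
  have c0: "cos \<theta>0 = \<nu> / z" using u by (simp add: \<theta>0_def)
  have "sin \<theta>0 = sqrt ((\<sigma>\<^sup>2 / z)\<^sup>2)"
  proof -
    have "1 - (\<nu> / z)\<^sup>2 = (\<sigma>\<^sup>2 / z)\<^sup>2"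
      using z \<sigma>(2) by (simp add: power_divide diff_divide_eq_iff divide_eq_eq flip: power_mult)
    moreover have "sin \<theta>0 = sqrt (1 - (\<nu> / z)\<^sup>2)"
      unfolding \<theta>0_def by (rule sin_arccos) (use u in linarith)+
    ultimately show ?thesis by (simp only:)
  qed
  then have s0: "sin \<theta>0 = \<sigma>\<^sup>2 / z" using z by simp
  have \<theta>0: "0 \<le> \<theta>0" "\<theta>0 \<le> pi / 2" unfolding \<theta>0_def by (rule arccos_lbound[of "\<nu> / z"] arccos_le_pi2; use u in linarith)+
  have \<delta>: "\<delta> > 0" using \<sigma> by (simp add: \<delta>_def)
  have "z * (2 * \<delta>) \<le> \<sigma>\<^sup>2"
    using \<sigma> by (simp add: \<delta>_def field_simps power3_eq_cube power2_eq_square)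
  then have \<delta>s: "2 * \<delta> \<le> sin \<theta>0" using z by (simp add: s0 field_simps)
  have s1: "sin \<theta>0 \<le> \<theta>0" using \<theta>0 by (intro sin_x_le_x)
  have ends: "0 \<le> \<theta>0 - \<delta>" "\<theta>0 + \<delta> \<le> pi"
    using \<delta> \<delta>s s1 sin_le_one[of \<theta>0] \<theta>0 pi_gt3 by linarith+
  have half: "\<delta> / 4 \<le> sin (\<delta> / 2)"
    using half_le_sin[of "\<delta> / 2"] \<delta> \<delta>s sin_le_one[of \<theta>0] by simp
  have near: "3 / 4 * sin \<theta>0 \<le> sin x" if "\<bar>x - \<theta>0\<bar> \<le> \<delta> / 2" for x
    using sin_lipschitz[of \<theta>0 x] that \<delta>s by linarith
  have \<sigma>\<delta>: "z * sin \<theta>0 * \<delta> = \<sigma> / 2" using z \<sigma> by (simp add: s0 \<delta>_def power2_eq_square)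
  \<comment> \<open>A difference of cosines across half the window is 2 sin(midpoint)
    sin(\<delta>/2). The two sine estimates and z sin \<theta>0 \<delta> = \<sigma>/2 give the
    constant 3/16.\<close>
  have prod: "3 / 16 * \<sigma> \<le> 2 * z * (sin x * sin (\<delta> / 2))" if "\<bar>x - \<theta>0\<bar> \<le> \<delta> / 2" for x
  proof -
    have "(3 / 4 * sin \<theta>0) * (\<delta> / 4) \<le> sin x * sin (\<delta> / 2)"
      using near[OF that] half \<delta> \<delta>s by (intro mult_mono) auto
    then have "2 * z * ((3 / 4 * sin \<theta>0) * (\<delta> / 4)) \<le> 2 * z * (sin x * sin (\<delta> / 2))"
      using z by (intro mult_left_mono) auto
    moreover have "2 * z * ((3 / 4 * sin \<theta>0) * (\<delta> / 4)) = 3 / 8 * (z * sin \<theta>0 * \<delta>)" by simp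
    ultimately show ?thesis by (simp only: \<sigma>\<delta>)
  qed
  have slope: "z * cos \<theta> - \<nu> = z * (cos \<theta> - cos \<theta>0)" for \<theta> using z by (simp add: c0 right_diff_distrib)
  have left0: "3 / 16 * \<sigma> \<le> z * cos (\<theta>0 - \<delta>) - \<nu>"
  proof -
    have "(\<theta>0 - \<delta> + \<theta>0) / 2 = \<theta>0 - \<delta> / 2" "(\<theta>0 - (\<theta>0 - \<delta>)) / 2 = \<delta> / 2"
      by (simp_all add: field_simps)
    then have "z * cos (\<theta>0 - \<delta>) - \<nu> = 2 * z * (sin (\<theta>0 - \<delta> / 2) * sin (\<delta> / 2))"
      unfolding slope cos_diff_cos by (simp only: mult_ac)
    then show ?thesis using prod[of "\<theta>0 - \<delta> / 2"] \<delta> by simp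
  qed
  have right0: "z * cos (\<theta>0 + \<delta>) - \<nu> \<le> - (3 / 16 * \<sigma>)"
  proof -
    have "(\<theta>0 + \<delta> + \<theta>0) / 2 = \<theta>0 + \<delta> / 2" "(\<theta>0 - (\<theta>0 + \<delta>)) / 2 = - (\<delta> / 2)"
      by (simp_all add: field_simps)
    then have "z * cos (\<theta>0 + \<delta>) - \<nu> = - (2 * z * (sin (\<theta>0 + \<delta> / 2) * sin (\<delta> / 2)))"
      unfolding slope cos_diff_cos by (simp only: mult_ac sin_minus mult_minus_right)
    then show ?thesis using prod[of "\<theta>0 + \<delta> / 2"] \<delta> by simp
  qed
  have left: "3 / 16 * \<sigma> \<le> z * cos \<theta> - \<nu>" if "0 \<le> \<theta>" "\<theta> \<le> \<theta>0 - \<delta>" for \<theta>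
  proof -
    have "cos (\<theta>0 - \<delta>) \<le> cos \<theta>" using that ends \<theta>0 \<delta> by (intro cos_monotone_0_pi_le) auto
    then have "z * cos (\<theta>0 - \<delta>) \<le> z * cos \<theta>" using z by (intro mult_left_mono) auto
    then show ?thesis using left0 by linarith
  qed
  have right: "z * cos \<theta> - \<nu> \<le> - (3 / 16 * \<sigma>)" if "\<theta>0 + \<delta> \<le> \<theta>" "\<theta> \<le> pi" for \<theta>
  proof -
    have "cos \<theta> \<le> cos (\<theta>0 + \<delta>)" using that ends \<theta>0 \<delta> by (intro cos_monotone_0_pi_le) auto
    then have "z * cos \<theta> \<le> z * cos (\<theta>0 + \<delta>)" using z by (intro mult_left_mono) auto
    then show ?thesis using right0 by linarith
  qed
  have inv: "1 / \<bar>z * cos \<theta> - \<nu>\<bar> \<le> 16 / (3 * \<sigma>)"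
    if "(0 \<le> \<theta> \<and> \<theta> \<le> \<theta>0 - \<delta>) \<or> (\<theta>0 + \<delta> \<le> \<theta> \<and> \<theta> \<le> pi)" for \<theta>
  proof -
    have "3 / 16 * \<sigma> \<le> \<bar>z * cos \<theta> - \<nu>\<bar>" using that left[of \<theta>] right[of \<theta>] by linarith
    then have "1 / \<bar>z * cos \<theta> - \<nu>\<bar> \<le> 1 / (3 / 16 * \<sigma>)"
      using \<sigma>(1) by (intro divide_left_mono mult_pos_pos) linarith+
    then show ?thesis by simp
  qed
  have nz: "z * cos \<theta> - \<nu> \<noteq> 0"
    if "(0 \<le> \<theta> \<and> \<theta> \<le> \<theta>0 - \<delta>) \<or> (\<theta>0 + \<delta> \<le> \<theta> \<and> \<theta> \<le> pi)" for \<theta>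
    using that left[of \<theta>] right[of \<theta>] \<sigma>(1) by linarith
  have mono: "\<nu> * cos \<theta> \<le> z" for \<theta>
    using mult_left_mono[OF cos_le_one[of \<theta>], of \<nu>] \<nu> by simp
  have mid: "0 \<le> sin \<theta> \<and> sin \<theta> \<le> 3 / 2 * sin \<theta>0" if "\<theta>0 - \<delta> \<le> \<theta>" "\<theta> \<le> \<theta>0 + \<delta>" for \<theta>
  proof
    show "0 \<le> sin \<theta>" using that ends by (intro sin_ge_zero) auto
    show "sin \<theta> \<le> 3 / 2 * sin \<theta>0" using sin_lipschitz[of \<theta> \<theta>0] that \<delta>s by linarith
  qed
  have "\<bar>integral {0..pi} (\<lambda>\<theta>. cos (z * sin \<theta> - \<nu> * \<theta> + c))\<bar> \<le> 64 / (3 * \<sigma>) + 1 * (\<theta>0 + \<delta> - (\<theta>0 - \<delta>)) + 64 / (3 * \<sigma>)"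
  proof (rule integral_split3[where b = "\<theta>0 - \<delta>" and c = "\<theta>0 + \<delta>"])
    show "\<bar>integral {0..\<theta>0 - \<delta>} (\<lambda>\<theta>. cos (z * sin \<theta> - \<nu> * \<theta> + c))\<bar> \<le> 64 / (3 * \<sigma>)"
      by (rule order_trans[OF oscillatory_bound_1]) (use ends \<theta>0 \<delta> z nz inv[of 0] inv[of "\<theta>0 - \<delta>"] in auto)
    show "\<bar>integral {\<theta>0 + \<delta>..pi} (\<lambda>\<theta>. cos (z * sin \<theta> - \<nu> * \<theta> + c))\<bar> \<le> 64 / (3 * \<sigma>)"
      by (rule order_trans[OF oscillatory_bound_1]) (use ends \<theta>0 \<delta> z nz inv[of "\<theta>0 + \<delta>"] inv[of pi] in auto)
    show "\<bar>integral {\<theta>0 - \<delta>..\<theta>0 + \<delta>} (\<lambda>\<theta>. cos (z * sin \<theta> - \<nu> * \<theta> + c))\<bar> \<le> 1 * (\<theta>0 + \<delta> - (\<theta>0 - \<delta>))"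
      by (rule abs_integral_le_length) (use \<delta> in \<open>auto intro!: continuous_intros\<close>)
  qed (use ends \<delta> in \<open>auto intro!: continuous_intros\<close>)
  also have "\<dots> \<le> 44 / \<sigma>" using \<sigma> by (simp add: \<delta>_def field_simps)
  finally show "\<bar>integral {0..pi} (\<lambda>\<theta>. cos (z * sin \<theta> - \<nu> * \<theta> + c))\<bar> \<le> 44 / \<sigma>" .
  \<comment> \<open>Only the inner endpoints count: at 0 and \<pi> the sine vanishes.\<close>
  have sb: "sin \<theta> / \<bar>z * cos \<theta> - \<nu>\<bar> \<le> 8 * \<sigma> / z" if "\<theta> = \<theta>0 - \<delta> \<or> \<theta> = \<theta>0 + \<delta>" for \<theta>
  proof -
    have "sin \<theta> * (1 / \<bar>z * cos \<theta> - \<nu>\<bar>) \<le> (3 / 2 * sin \<theta>0) * (16 / (3 * \<sigma>))"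
      using that mid[of \<theta>] inv[of \<theta>] ends \<delta> \<delta>s by (intro mult_mono) auto
    also have "\<dots> = 8 * \<sigma> / z" using \<sigma> by (simp add: s0 power2_eq_square)
    finally show ?thesis by simp
  qed
  have "\<bar>integral {0..pi} (\<lambda>\<theta>. sin \<theta> * cos (z * sin \<theta> - \<nu> * \<theta> + c))\<bar> \<le>
      16 * \<sigma> / z + 3 / 2 * sin \<theta>0 * (\<theta>0 + \<delta> - (\<theta>0 - \<delta>)) + 16 * \<sigma> / z"
  proof (rule integral_split3[where b = "\<theta>0 - \<delta>" and c = "\<theta>0 + \<delta>"])
    show "\<bar>integral {0..\<theta>0 - \<delta>} (\<lambda>\<theta>. sin \<theta> * cos (z * sin \<theta> - \<nu> * \<theta> + c))\<bar> \<le> 16 * \<sigma> / z"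
      by (rule order_trans[OF oscillatory_bound_sin]) (use ends \<theta>0 \<delta> z nz mono sb[of "\<theta>0 - \<delta>"] in auto)
    show "\<bar>integral {\<theta>0 + \<delta>..pi} (\<lambda>\<theta>. sin \<theta> * cos (z * sin \<theta> - \<nu> * \<theta> + c))\<bar> \<le> 16 * \<sigma> / z"
      by (rule order_trans[OF oscillatory_bound_sin]) (use ends \<theta>0 \<delta> z nz mono sb[of "\<theta>0 + \<delta>"] in auto)
    have "\<bar>sin \<theta> * cos (z * sin \<theta> - \<nu> * \<theta> + c)\<bar> \<le> 3 / 2 * sin \<theta>0 * 1" if "\<theta> \<in> {\<theta>0 - \<delta>..\<theta>0 + \<delta>}" for \<theta>
      unfolding abs_mult using mid[of \<theta>] that by (intro mult_mono) auto
    then show "\<bar>integral {\<theta>0 - \<delta>..\<theta>0 + \<delta>} (\<lambda>\<theta>. sin \<theta> * cos (z * sin \<theta> - \<nu> * \<theta> + c))\<bar> \<le>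
        3 / 2 * sin \<theta>0 * (\<theta>0 + \<delta> - (\<theta>0 - \<delta>))"
      by (intro abs_integral_le_length) (use \<delta> in \<open>auto intro!: continuous_intros\<close>)
  qed (use ends \<delta> in \<open>auto intro!: continuous_intros\<close>)
  also have "\<dots> \<le> 34 * \<sigma> / z" using \<sigma> z by (simp add: \<delta>_def s0 field_simps power2_eq_square)
  finally show "\<bar>integral {0..pi} (\<lambda>\<theta>. sin \<theta> * cos (z * sin \<theta> - \<nu> * \<theta> + c))\<bar> \<le> 34 * \<sigma> / z" .
qed

section \<open>The half-line integral under a linear bound on its exponent, and the oscillatory
  regime\<close>

lemma sinh_ge_self: "0 \<le> s \<Longrightarrow> s \<le> sinh (s::real)"
  using real_le_x_sinh[of s] by (simp add: sinh_field_def exp_minus)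

lemma sinh_le_mult_exp: "sinh (s::real) \<le> s * exp s"
proof -
  have "1 + - 2 * s \<le> exp (- 2 * s)" by (rule exp_ge_add_one_self)
  then have "exp s * (1 - exp (- 2 * s)) \<le> exp s * (2 * s)" by (intro mult_left_mono[of "1 - exp (- 2 * s)"]) auto
  moreover have "exp s * (1 - exp (- 2 * s)) = 2 * sinh s"
    by (simp add: sinh_field_def right_diff_distrib flip: exp_add)
  ultimately have "2 * sinh s \<le> exp s * (2 * s)" by argo
  then show ?thesis by (simp add: mult_ac)
qed

text \<open>In the second bound sinh s \<le> s exp s, s \<le> (4/m) exp(ms/4), and m \<ge> 4 lets
  exp s be absorbed by exp(ms/4) as well; decay at rate m/2 remains, whose integral yields
  (4/m)(2/m).\<close>

lemma bessel_E_upper: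
  assumes z: "z > 0" and m: "m \<ge> 4" and p: "\<And>s. s \<ge> 0 \<Longrightarrow> \<nu> * s - z * sinh s \<le> M - m * s"
  shows "bessel_E (- \<nu>) z \<le> exp M / m" "bessel_E1 (- \<nu>) z \<le> 8 * exp M / m\<^sup>2"
proof -
  have p': "exp (- (- \<nu> * s) - z * sinh s) \<le> exp M * exp (- m * s)" if "s \<ge> 0" for s
    using p[OF that] by (simp flip: exp_add)
  have i: "((\<lambda>s. exp (- a * s)) has_integral 1 / a) {0..}" if "a > 0" for a :: real
    using has_integral_exp_minus_to_infinity[OF that, of 0] by simp
  have "((\<lambda>s. exp M * exp (- m * s)) has_integral exp M * (1 / m)) {0..}"
    using m by (intro has_integral_mult_right i) auto
  then have "bessel_E (- \<nu>) z \<le> exp M * (1 / m)"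
    unfolding bessel_E_def
    by (rule has_integral_le[OF integrable_integral[OF bessel_E_integrable[OF z]]]) (use p' in auto)
  then show "bessel_E (- \<nu>) z \<le> exp M / m" by simp
  have "((\<lambda>s. 4 / m * exp M * exp (- (m / 2) * s)) has_integral 4 / m * exp M * (1 / (m / 2))) {0..}"
    using m by (intro has_integral_mult_right i) auto
  moreover have "sinh s * exp (- (- \<nu> * s) - z * sinh s) \<le> 4 / m * exp M * exp (- (m / 2) * s)" if s: "s \<ge> 0" for s
  proof -
    have "1 + m * s / 4 \<le> exp (m * s / 4)" by (rule exp_ge_add_one_self)
    then have "m * s / 4 \<le> exp (m * s / 4)" by linarith
    then have "s \<le> 4 / m * exp (m * s / 4)" using m by (simp add: field_simps)
    then have "s * exp s \<le> 4 / m * exp (m * s / 4) * exp s" by (intro mult_right_mono) auto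
    with sinh_le_mult_exp[of s] have "sinh s \<le> 4 / m * exp (m * s / 4) * exp s" by linarith
    then have "sinh s * exp (- (- \<nu> * s) - z * sinh s) \<le> (4 / m * exp (m * s / 4) * exp s) * (exp M * exp (- m * s))"
      using p'[OF s] m s by (intro mult_mono) auto
    also have "\<dots> = 4 / m * exp M * exp (m * s / 4 + s - m * s)"
      by (simp only: exp_add exp_diff exp_minus mult_minus_left) (simp add: field_simps)
    also have "\<dots> \<le> 4 / m * exp M * exp (- (m / 2) * s)"
    proof -
      have "4 * s \<le> m * s" using m s by (intro mult_right_mono) auto
      then have "m * s / 4 + s - m * s \<le> - (m / 2) * s" by (simp add: field_simps)
      then show ?thesis using m by (intro mult_left_mono) auto
    qed
    finally show ?thesis .
  qed
  ultimately have "bessel_E1 (- \<nu>) z \<le> 4 / m * exp M * (1 / (m / 2))"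
    unfolding bessel_E1_def
    by (intro has_integral_le[OF integrable_integral[OF has_integral_integrable[OF bessel_E1_has_integral[OF z]]]]) auto
  then show "bessel_E1 (- \<nu>) z \<le> 8 * exp M / m\<^sup>2" by (simp add: power2_eq_square)
qed

text \<open>The hypothesis z \<le> (z-\<nu>)^3 replaces the quotient by \<nu>^(1/3), so \<nu> = 0
  and small \<nu> need no special treatment. With b = z - \<nu> it yields \<sigma> \<le> 2b, z \<le>
  \<sigma>^3 and z \<le> b^2 \<sigma>, which bring E and E1 to the sizes 1/\<sigma> and \<sigma>/z
  of the oscillating integrals. These comparisons are made for fourth powers, where \<sigma>^4 = b
  (z+\<nu>).\<close>

lemma hankel_oscillatory_region:
  assumes z: "z \<ge> 64" and \<nu>: "0 \<le> \<nu>" "\<nu> \<le> z" and b: "z \<le> (z - \<nu>) ^ 3"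
    and \<sigma>: "\<sigma> > 0" "\<sigma> ^ 4 = z\<^sup>2 - \<nu>\<^sup>2"
  shows "1 / (46 * \<sigma>) \<le> cmod (hankel_H1 \<nu> z)" "cmod (hankel_H1 \<nu> z) \<le> 94 / \<sigma>"
proof -
  define b where "b = z - \<nu>"
  have z0: "z > 0" using z by simp
  have b0: "b \<ge> 0" and b3: "z \<le> b ^ 3" using \<nu> b by (auto simp: b_def)
  have b4: "b \<ge> 4" 
  proof (rule ccontr)
    assume "\<not> b \<ge> 4"
    then have "b ^ 3 < 4 ^ 3" using b0 by (intro power_strict_mono) auto
    then show False using b3 z by simp
  qed
  have \<sigma>4: "\<sigma> ^ 4 = b * (z + \<nu>)" by (simp add: b_def \<sigma> algebra_simps power2_eq_square)
  have "\<sigma> ^ 4 \<le> b * (2 * b ^ 3)"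
    unfolding \<sigma>4 using \<nu> b0 b3 by (intro mult_left_mono) auto
  also have "\<dots> \<le> (2 * b) ^ 4" using b0 by (simp add: power_mult_distrib eval_nat_numeral)
  finally have \<sigma>b: "\<sigma> \<le> 2 * b" using b0 by (intro power_le_imp_le_base[of \<sigma> 3]) auto
  have \<sigma>3: "z \<le> \<sigma> ^ 3"
  proof -
    have "z ^ 4 = z * z ^ 3" by (simp add: eval_nat_numeral)
    also have "\<dots> \<le> b ^ 3 * (z + \<nu>) ^ 3" using b3 z0 \<nu> b0 by (intro mult_mono power_mono) auto
    also have "\<dots> = (\<sigma> ^ 4) ^ 3" unfolding \<sigma>4 by (rule power_mult_distrib[symmetric])
    also have "\<dots> = (\<sigma> ^ 3) ^ 4" by (simp flip: power_mult)
    finally show ?thesis using \<sigma> by (intro power_le_imp_le_base[of z 3]) auto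
  qed
  have b2: "z \<le> b\<^sup>2 * \<sigma>"
  proof -
    have "z ^ 4 = z ^ 3 * z" by (simp add: eval_nat_numeral)
    also have "\<dots> \<le> (b ^ 3) ^ 3 * (z + \<nu>)" using b3 z0 \<nu> b0 by (intro mult_mono power_mono) auto
    also have "\<dots> = b ^ 8 * \<sigma> ^ 4" unfolding \<sigma>4 by (simp add: eval_nat_numeral)
    also have "\<dots> = (b\<^sup>2 * \<sigma>) ^ 4" by (simp add: power_mult_distrib flip: power_mult)
    finally show ?thesis using \<sigma> by (intro power_le_imp_le_base[of z 3]) auto
  qed
  have "\<nu> * s - z * sinh s \<le> 0 - b * s" if "s \<ge> 0" for s
    using mult_left_mono[OF sinh_ge_self[OF that], of z] z0 by (simp add: b_def algebra_simps)
  note E = bessel_E_upper[OF z0 b4 this]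
  have E0: "bessel_E (- \<nu>) z \<le> 2 / \<sigma>"
  proof -
    have "1 / b \<le> 2 / \<sigma>" using \<sigma> \<sigma>b b4 by (simp add: field_simps)
    then show ?thesis using E(1) by simp
  qed
  have E1: "bessel_E1 (- \<nu>) z \<le> 8 * (\<sigma> / z)"
  proof -
    have "1 / b\<^sup>2 \<le> \<sigma> / z" using z0 b2 b4 by (simp add: field_simps)
    then show ?thesis using E(2) by simp
  qed
  note PQ = bessel_oscillatory_bounds[OF oscillatory_region_bounds(1)[OF z0 \<nu> \<sigma> \<sigma>3]]
  note PQ1 = bessel_oscillatory_bounds_1[OF oscillatory_region_bounds(2)[OF z0 \<nu> \<sigma> \<sigma>3]]
  have "pi * cmod (hankel_H1 \<nu> z) \<le> 94 / \<sigma>"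
    using hankel_upper[OF z0 \<nu>(1)] PQ E0 by (simp add: field_simps)
  moreover have "1 * cmod (hankel_H1 \<nu> z) \<le> pi * cmod (hankel_H1 \<nu> z)"
    using pi_gt3 by (intro mult_right_mono) auto
  ultimately show "cmod (hankel_H1 \<nu> z) \<le> 94 / \<sigma>" by simp
  define D where "D = cmod (hankel_H1 (\<nu> - 1) z - hankel_H1 (\<nu> + 1) z)"
  have D: "pi * D \<le> 184 * \<sigma> / z"
    using hankel_difference_upper[OF z0 \<nu>(1)] PQ1 E1 by (simp add: D_def)
  have "4 / z \<le> cmod (hankel_H1 \<nu> z) * (pi * D)"
    using hankel_lower_from_difference[OF z0, of \<nu>] z0 by (simp add: D_def field_simps)
  also have "\<dots> \<le> cmod (hankel_H1 \<nu> z) * (184 * \<sigma> / z)" by (intro mult_left_mono D) auto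
  finally show "1 / (46 * \<sigma>) \<le> cmod (hankel_H1 \<nu> z)" using z0 \<sigma> by (simp add: field_simps)
qed

subsection \<open>The transition region and the Laplace peak\<close>

lemma sinh_ge_cubic:
  assumes "0 \<le> (s::real)"
  shows "s + s ^ 3 / 6 \<le> sinh s"
proof -
  have "(\<Sum>n<4. if even n then 0 else s ^ n /\<^sub>R fact n) \<le> (\<Sum>n. if even n then 0 else s ^ n /\<^sub>R fact n)"
    using sums_summable[OF sinh_converges[of s]] assms by (intro sum_le_suminf) auto
  also have "\<dots> = sinh s" using sinh_converges[of s] by (simp add: sums_iff)
  also have "{..<4} = {0, 1, 2, 3::nat}" by auto
  finally show ?thesis by (simp add: fact_numeral field_simps)
qed

text \<open>Any stationary point lies below \<delta> = 60/n, so one cut suffices. There z (1 - cos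
  \<delta>) \<ge> 225 n outweighs the admissible deviation 200 n and leaves slope at most -25 n. The
  extra factor sin \<theta> \<le> \<delta> near 0 improves 1/n to 1/n^2. The condition n \<ge> 60
  gives \<delta> \<le> 1 and n^3 \<ge> 3600 n, so z and n^3 are comparable.\<close>

lemma transition_region_bounds:
  assumes n: "n \<ge> 60" and z: "\<bar>z - n ^ 3\<bar> \<le> 200 * n"
  shows "\<bar>integral {0..pi} (\<lambda>\<theta>. cos (z * sin \<theta> - n ^ 3 * \<theta> + c))\<bar> \<le> 63 / n"
    and "\<bar>integral {0..pi} (\<lambda>\<theta>. sin \<theta> * cos (z * sin \<theta> - n ^ 3 * \<theta> + c))\<bar> \<le> 3605 / n\<^sup>2"
proof -
  define \<delta> where "\<delta> = 60 / n"
  have "0 < \<delta>" "\<delta> \<le> 1" using n by (auto simp: \<delta>_def)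
  then have \<delta>: "0 < \<delta>" "\<delta> \<le> 1" "\<delta> \<le> pi" using pi_gt3 by linarith+
  have "60 * 60 * n \<le> n * n * n" using n by (intro mult_right_mono mult_mono) auto
  then have n3: "3600 * n \<le> n ^ 3" by (simp add: power3_eq_cube)
  then have z2: "n ^ 3 / 2 \<le> z" using z n unfolding abs_le_iff by linarith
  have z0: "z > 0" using z2 n by (intro less_le_trans[OF _ z2]) auto
  have "1 - cos \<delta> = 2 * (sin (\<delta> / 2))\<^sup>2" using cos_double_sin[of "\<delta> / 2"] by simp
  moreover have "(\<delta> / 4)\<^sup>2 \<le> (sin (\<delta> / 2))\<^sup>2"
    using half_le_sin[of "\<delta> / 2"] \<delta> by (intro power_mono) auto
  ultimately have cos\<delta>: "\<delta>\<^sup>2 / 8 \<le> 1 - cos \<delta>" by (simp add: power2_eq_square)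
  have "n ^ 3 * (\<delta>\<^sup>2 / 8) = n * (n * \<delta>)\<^sup>2 / 8" by (simp add: power2_eq_square power3_eq_cube)
  also have "n * \<delta> = 60" using n by (simp add: \<delta>_def)
  also have "n * 60\<^sup>2 / 8 = 450 * n" by simp
  finally have n\<delta>: "n ^ 3 * (\<delta>\<^sup>2 / 8) = 450 * n" .
  have "n ^ 3 / 2 * (\<delta>\<^sup>2 / 8) \<le> z * (1 - cos \<delta>)" using z2 cos\<delta> z0 by (intro mult_mono) auto
  then have "225 * n \<le> z * (1 - cos \<delta>)" using n\<delta> by linarith
  then have \<delta>s: "z * cos \<delta> - n ^ 3 \<le> - (25 * n)" using z unfolding abs_le_iff by (simp add: right_diff_distrib)
  have le: "cos \<theta> \<le> cos \<delta>" if "\<theta> \<in> {\<delta>..pi}" for \<theta>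
    using that \<delta> by (intro cos_monotone_0_pi_le) auto
  have nz: "z * cos \<theta> - n ^ 3 \<noteq> 0" if "\<theta> \<in> {\<delta>..pi}" for \<theta>
    using mult_left_mono[OF le[OF that], of z] z0 \<delta>s n by linarith
  have mono: "n ^ 3 * cos \<theta> \<le> z" if "\<theta> \<in> {\<delta>..pi}" for \<theta>
  proof -
    have "n ^ 3 * cos \<theta> \<le> n ^ 3 * (1 - \<delta>\<^sup>2 / 8)" using le[OF that] cos\<delta> n by (intro mult_left_mono) auto
    also have "\<dots> = n ^ 3 - 450 * n" by (simp only: right_diff_distrib n\<delta> mult_1_right)
    finally show ?thesis using z n unfolding abs_le_iff by linarith
  qed
  have inv\<delta>: "1 / \<bar>z * cos \<delta> - n ^ 3\<bar> \<le> 1 / (25 * n)"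
    using \<delta>s n by (intro divide_left_mono) auto
  have "n \<le> \<bar>z * cos pi - n ^ 3\<bar>" using z0 n3 n by simp
  then have inv\<pi>: "1 / \<bar>z * cos pi - n ^ 3\<bar> \<le> 1 / n"
    using n by (intro divide_left_mono) auto
  have "\<bar>integral {0..pi} (\<lambda>\<theta>. cos (z * sin \<theta> - n ^ 3 * \<theta> + c))\<bar> \<le> 0 + 1 * (\<delta> - 0) + 2 * (1 / (25 * n) + 1 / n)"
  \<comment> \<open>The first of the three pieces is degenerate, hence the summand 0.\<close>
  proof (rule integral_split3[where b = 0 and c = \<delta>])
    show "\<bar>integral {\<delta>..pi} (\<lambda>\<theta>. cos (z * sin \<theta> - n ^ 3 * \<theta> + c))\<bar> \<le> 2 * (1 / (25 * n) + 1 / n)"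
      by (rule order_trans[OF oscillatory_bound_1])
        (use \<delta> z0 nz inv\<delta> inv\<pi> in \<open>auto simp del: cos_pi intro!: add_mono\<close>)
    show "\<bar>integral {0..\<delta>} (\<lambda>\<theta>. cos (z * sin \<theta> - n ^ 3 * \<theta> + c))\<bar> \<le> 1 * (\<delta> - 0)"
      by (rule abs_integral_le_length) (use \<delta> in \<open>auto intro!: continuous_intros\<close>)
  qed (use \<delta> in \<open>auto intro!: continuous_intros\<close>)
  also have "\<dots> \<le> 63 / n" using n by (simp add: \<delta>_def field_simps)
  finally show "\<bar>integral {0..pi} (\<lambda>\<theta>. cos (z * sin \<theta> - n ^ 3 * \<theta> + c))\<bar> \<le> 63 / n" .
  have sin\<delta>: "0 \<le> sin \<theta> \<and> sin \<theta> \<le> \<delta>" if "\<theta> \<in> {0..\<delta>}" for \<theta>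
    using that \<delta> sin_x_le_x[of \<theta>] by (auto intro: sin_ge_zero)
  have "\<bar>integral {0..pi} (\<lambda>\<theta>. sin \<theta> * cos (z * sin \<theta> - n ^ 3 * \<theta> + c))\<bar> \<le>
      0 + \<delta> * 1 * (\<delta> - 0) + 2 * (\<delta> * (1 / (25 * n)))"
  proof (rule integral_split3[where b = 0 and c = \<delta>])
    have "sin \<delta> * (1 / \<bar>z * cos \<delta> - n ^ 3\<bar>) \<le> \<delta> * (1 / (25 * n))"
      using inv\<delta> sin\<delta>[of \<delta>] \<delta> by (intro mult_mono) auto
    then show "\<bar>integral {\<delta>..pi} (\<lambda>\<theta>. sin \<theta> * cos (z * sin \<theta> - n ^ 3 * \<theta> + c))\<bar> \<le> 2 * (\<delta> * (1 / (25 * n)))"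
      by (intro order_trans[OF oscillatory_bound_sin]) (use \<delta> z0 nz mono in auto)
    have "\<bar>sin \<theta> * cos (z * sin \<theta> - n ^ 3 * \<theta> + c)\<bar> \<le> \<delta> * 1" if "\<theta> \<in> {0..\<delta>}" for \<theta>
      unfolding abs_mult using sin\<delta>[OF that] \<delta> by (intro mult_mono) auto
    then show "\<bar>integral {0..\<delta>} (\<lambda>\<theta>. sin \<theta> * cos (z * sin \<theta> - n ^ 3 * \<theta> + c))\<bar> \<le> \<delta> * 1 * (\<delta> - 0)"
      by (intro abs_integral_le_length) (use \<delta> in \<open>auto intro!: continuous_intros\<close>)
  qed (use \<delta> in \<open>auto intro!: continuous_intros\<close>)
  also have "\<dots> \<le> 3605 / n\<^sup>2" using n by (simp add: \<delta>_def field_simps power2_eq_square)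
  finally show "\<bar>integral {0..pi} (\<lambda>\<theta>. sin \<theta> * cos (z * sin \<theta> - n ^ 3 * \<theta> + c))\<bar> \<le> 3605 / n\<^sup>2" .
qed

lemma hankel_transition_region:
  assumes n: "n \<ge> 60" and z: "\<bar>z - n ^ 3\<bar> \<le> 200 * n"
  shows "1 / ((7210 + 24 * exp 10050) * n) \<le> cmod (hankel_H1 (n ^ 3) z)"
    and "cmod (hankel_H1 (n ^ 3) z) \<le> (126 + 3 * exp 10050) / n"
proof -
  have "60 * 60 * n \<le> n * n * n" using n by (intro mult_right_mono mult_mono) auto
  then have "3600 * n \<le> n ^ 3" by (simp add: power3_eq_cube)
  then have z2: "n ^ 3 / 2 \<le> z" "z \<le> 2 * n ^ 3" using z n unfolding abs_le_iff by linarith+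
  have z0: "z > 0" using n by (intro less_le_trans[OF _ z2(1)]) auto
  have "n ^ 3 * s - z * sinh s \<le> 10050 - n * s" if s: "s \<ge> 0" for s
  proof -
    \<comment> \<open>In the scaled variable the exponent is at most 200 \<tau> - \<tau>^3/12. To
      gain the decay -\<tau>, compare 201 \<tau> with the cubic: up to \<tau> = 50 it is at most 201
      * 50 = 10050, and beyond 50 the cubic wins because 2500/12 > 201.\<close>
    define \<tau> where "\<tau> = n * s"
    have "z * (s + s ^ 3 / 6) \<le> z * sinh s" using sinh_ge_cubic[OF s] z0 by (intro mult_left_mono) auto
    moreover have "n ^ 3 / 2 * (s ^ 3 / 6) \<le> z * (s ^ 3 / 6)" using z2 s by (intro mult_right_mono) auto
    then have "\<tau> ^ 3 / 12 \<le> z * (s ^ 3 / 6)" by (simp add: \<tau>_def power_mult_distrib)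
    moreover have "(n ^ 3 - z) * s \<le> 200 * n * s" using z s by (intro mult_right_mono) auto
    then have "n ^ 3 * s - z * s \<le> 200 * \<tau>" by (simp add: \<tau>_def left_diff_distrib)
    moreover have "201 * \<tau> \<le> 10050 + \<tau> ^ 3 / 12"
    proof (cases "\<tau> \<le> 50")
      case True
      then show ?thesis using s n by (simp add: \<tau>_def zero_le_power add_increasing2)
    next
      case False
      then have "50 * 50 * \<tau> \<le> \<tau> * \<tau> * \<tau>" by (intro mult_right_mono mult_mono) auto
      then have "2500 * \<tau> \<le> \<tau> ^ 3" unfolding power3_eq_cube by linarith
      then show ?thesis using False by linarith
    qed
    ultimately show ?thesis by (simp add: distrib_left \<tau>_def)
  qed
  note E = bessel_E_upper[OF z0 _ this]
  note PQ = bessel_oscillatory_bounds[OF transition_region_bounds(1)[OF n z]]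
  note PQ1 = bessel_oscillatory_bounds_1[OF transition_region_bounds(2)[OF n z]]
  have \<nu>: "n ^ 3 \<ge> 0" using n by simp
  have "pi * cmod (hankel_H1 (n ^ 3) z) \<le> 63 / n + 63 / n + 3 * (exp 10050 / n)"
    using hankel_upper[OF z0 \<nu>] PQ E(1) n by linarith
  also have "\<dots> = (126 + 3 * exp 10050) / n" by (simp add: add_divide_distrib)
  finally have "pi * cmod (hankel_H1 (n ^ 3) z) \<le> (126 + 3 * exp 10050) / n" .
  moreover have "1 * cmod (hankel_H1 (n ^ 3) z) \<le> pi * cmod (hankel_H1 (n ^ 3) z)"
    using pi_gt3 by (intro mult_right_mono) auto
  ultimately show "cmod (hankel_H1 (n ^ 3) z) \<le> (126 + 3 * exp 10050) / n" by simp
  define D where "D = cmod (hankel_H1 (n ^ 3 - 1) z - hankel_H1 (n ^ 3 + 1) z)"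
  define K :: real where "K = 7210 + 24 * exp 10050"
  have K: "K > 0" unfolding K_def by (intro add_pos_pos mult_pos_pos) auto
  have "pi * D \<le> 2 * (3605 / n\<^sup>2 + 3605 / n\<^sup>2 + 3 * (8 * exp 10050 / n\<^sup>2))"
    unfolding D_def using PQ1 E(2) n by (intro order_trans[OF hankel_difference_upper[OF z0 \<nu>]]) auto
  also have "\<dots> = 2 * K / n\<^sup>2" by (simp add: K_def add_divide_distrib)
  finally have D: "pi * D \<le> 2 * K / n\<^sup>2" .
  have "4 / (2 * n ^ 3) \<le> 4 / z" using z0 z2 n by (intro divide_left_mono) auto
  also have "4 / z \<le> cmod (hankel_H1 (n ^ 3) z) * (pi * D)"
    using hankel_lower_from_difference[OF z0, of "n ^ 3"] z0 by (simp add: D_def field_simps)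
  also have "\<dots> \<le> cmod (hankel_H1 (n ^ 3) z) * (2 * K / n\<^sup>2)" by (intro mult_left_mono D) auto
  finally show "1 / ((7210 + 24 * exp 10050) * n) \<le> cmod (hankel_H1 (n ^ 3) z)"
    unfolding K_def[symmetric] using n K by (simp add: field_simps power2_eq_square power3_eq_cube)
qed

text \<open>The exponent p(s) = \<nu>s - z sinh s peaks at t0 with value \<eta> and second
  derivative -\<sigma>^2. Above, it is majorised by a tent of slope \<sigma>/4; below, it loses at
  most 1 on the interval of length 1/\<sigma> to the left of t0. The condition 3z \<le> \<sigma>^3
  keeps that interval inside the half-line.\<close>

lemma bessel_E_laplace:
  assumes z: "z > 0" and t0: "t0 > 0" and \<nu>: "\<nu> = z * cosh t0" and \<sigma>: "\<sigma> \<ge> 1" "\<sigma>\<^sup>2 = z * sinh t0" "3 * z \<le> \<sigma> ^ 3"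
  defines "\<eta> \<equiv> \<nu> * t0 - \<sigma>\<^sup>2"
  shows "exp (\<eta> - 1) / \<sigma> \<le> bessel_E (- \<nu>) z" "bessel_E (- \<nu>) z \<le> 16 * exp \<eta> / \<sigma>" "0 \<le> \<eta>"
proof -
  define \<delta> where "\<delta> = 1 / \<sigma>"
  define p where "p = (\<lambda>s. \<nu> * s - z * sinh s)"
  have \<delta>: "0 < \<delta>" "\<delta> \<le> 1" and \<sigma>\<delta>: "\<sigma> * \<delta> = 1" using \<sigma> by (auto simp: \<delta>_def)
  have S\<delta>: "z * sinh t0 * \<delta> = \<sigma>" using \<sigma> by (simp add: \<delta>_def flip: \<sigma>(2)) (simp add: power2_eq_square)
  have p': "(p has_real_derivative z * (cosh t0 - cosh s)) (at s)" for s
    unfolding p_def by (auto intro!: derivative_eq_intros simp: \<nu> right_diff_distrib)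
  have pt0: "p t0 = \<eta>" by (simp add: p_def \<eta>_def \<sigma>)
  have exp1: "exp x \<le> 3" if "x \<le> 1" for x :: real using exp_le that by (smt (verit) exp_le_cancel_iff)
  \<comment> \<open>Otherwise t0 < \<delta> \<le> 1 and sinh t0 \<le> t0 exp t0 < 3\<delta>, against
    3z \<le> \<sigma>^3.\<close>
  have \<delta>t0: "\<delta> \<le> t0"
  proof (rule ccontr)
    assume "\<not> \<delta> \<le> t0"
    then have "t0 * exp t0 \<le> t0 * 3" "t0 * 3 < \<delta> * 3" using t0 \<delta> exp1[of t0] by (auto intro: mult_left_mono)
    then have "sinh t0 < \<delta> * 3" using sinh_le_mult_exp[of t0] by linarith
    then have "z * sinh t0 < z * (\<delta> * 3)" using z by (intro mult_strict_left_mono) auto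
    then have "\<sigma>\<^sup>2 * \<sigma> < 3 * z" using \<sigma> by (simp add: \<delta>_def field_simps)
    then show False using \<sigma>(3) by (simp add: power2_eq_square power3_eq_cube)
  qed
  have sh\<delta>: "\<delta> / 2 \<le> sinh (\<delta> / 2)" using \<delta> by (intro sinh_ge_self) auto
  have cosh_diff': "cosh (a + b) - cosh (a - b) = 2 * (sinh a * sinh b)" for a b :: real
    by (simp add: cosh_add cosh_diff)
  \<comment> \<open>To the left of the peak sinh decreases, and its value midway in the window must
    stay comparable to sinh t0. In the addition formula for y + x, sinh(y-x) \<ge> 0 bounds the
    second product by the first, and cosh x \<le> 2.\<close>
  have quarter: "sinh t0 \<le> 4 * sinh (t0 - \<delta> / 2)"
  proof -
    define x y where "x = \<delta> / 2" and "y = t0 - \<delta> / 2"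
    have "0 \<le> sinh (y - x)" using \<delta>t0 by (simp add: x_def y_def)
    then have 1: "cosh y * sinh x \<le> sinh y * cosh x" by (simp add: sinh_diff)
    have "cosh x \<le> 2" using exp1[of x] exp1[of "- x"] \<delta> by (simp add: cosh_field_def x_def)
      (smt (verit) exp_le_one_iff exp1)
    then have 2: "sinh y * cosh x \<le> sinh y * 2" using \<delta>t0 \<delta> by (intro mult_left_mono) (auto simp: y_def)
    have "t0 = y + x" by (simp add: x_def y_def)
    then have "sinh t0 = sinh y * cosh x + cosh y * sinh x" by (simp only: sinh_add)
    then show ?thesis using 1 2 by (simp add: y_def)
  qed
  have left: "\<sigma> / 4 \<le> z * (cosh t0 - cosh s)" if "0 \<le> s" "s \<le> t0 - \<delta>" for s
  proof -
    have "(sinh t0 / 4) * (\<delta> / 2) \<le> sinh (t0 - \<delta> / 2) * sinh (\<delta> / 2)"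
      using quarter sh\<delta> t0 \<delta> \<delta>t0 by (intro mult_mono) auto
    then have "sinh t0 * \<delta> / 4 \<le> cosh t0 - cosh (t0 - \<delta>)"
      using cosh_diff'[of "t0 - \<delta> / 2" "\<delta> / 2"] by simp
    also have "\<dots> \<le> cosh t0 - cosh s" using that by (simp add: cosh_real_nonneg_le_iff)
    finally have "z * (sinh t0 * \<delta> / 4) \<le> z * (cosh t0 - cosh s)" using z by (intro mult_left_mono) auto
    then show ?thesis using S\<delta> by simp
  qed
  have right: "\<sigma> / 4 \<le> z * (cosh s - cosh t0)" if "t0 + \<delta> \<le> s" for s
  proof -
    have "sinh t0 * (\<delta> / 2) \<le> sinh (t0 + \<delta> / 2) * sinh (\<delta> / 2)"
      using sh\<delta> t0 \<delta> by (intro mult_mono) auto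
    then have "sinh t0 * \<delta> \<le> cosh (t0 + \<delta>) - cosh t0"
      using cosh_diff'[of "t0 + \<delta> / 2" "\<delta> / 2"] by (simp add: add.commute)
    also have "\<dots> \<le> cosh s - cosh t0" using that t0 \<delta> by (simp add: cosh_real_nonneg_le_iff)
    finally have "z * (sinh t0 * \<delta>) \<le> z * (cosh s - cosh t0)" using z by (intro mult_left_mono) auto
    then show ?thesis using S\<delta> \<sigma> by simp
  qed
  have max: "p s \<le> \<eta>" if "s \<ge> 0" for s
  proof (cases "s \<le> t0")
    case True
    have "p s \<le> p t0"
    proof (rule DERIV_nonneg_imp_nondecreasing[OF True])
      fix x assume "s \<le> x" "x \<le> t0"
      then have "0 \<le> z * (cosh t0 - cosh x)" using z that by (simp add: cosh_real_nonneg_le_iff)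
      then show "\<exists>d. (p has_real_derivative d) (at x) \<and> 0 \<le> d" using p' by blast
    qed
    then show ?thesis by (simp add: pt0)
  next
    case False
    then have "t0 \<le> s" by simp
    then have "p t0 \<ge> p s"
    proof (rule DERIV_nonpos_imp_nonincreasing)
      fix x assume "t0 \<le> x" "x \<le> s"
      then have "z * (cosh t0 - cosh x) \<le> 0" using z t0 by (simp add: mult_le_0_iff cosh_real_nonneg_le_iff)
      then show "\<exists>d. (p has_real_derivative d) (at x) \<and> d \<le> 0" using p' by blast
    qed
    then show ?thesis by (simp add: pt0)
  qed
  show "0 \<le> \<eta>" using max[of 0] by (simp add: p_def)
  \<comment> \<open>The excess 1/4 = \<sigma>\<delta>/4 is the drop of the tent across half the
    window, where only p \<le> \<eta> is known.\<close>
  have tent: "p s \<le> \<eta> + 1 / 4 - \<sigma> / 4 * \<bar>s - t0\<bar>" if s: "s \<ge> 0" for s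
  proof -
    consider "s \<le> t0 - \<delta>" | "t0 - \<delta> \<le> s" "s \<le> t0 + \<delta>" | "t0 + \<delta> \<le> s" by linarith
    then show ?thesis
    proof cases
      case 1
      then have "p s - \<sigma> / 4 * s \<le> p (t0 - \<delta>) - \<sigma> / 4 * (t0 - \<delta>)"
      proof (rule DERIV_nonneg_imp_nondecreasing)
        fix x assume "s \<le> x" "x \<le> t0 - \<delta>"
        then have "0 \<le> z * (cosh t0 - cosh x) - \<sigma> / 4" using left[of x] s by simp
        moreover have "((\<lambda>s. p s - \<sigma> / 4 * s) has_real_derivative z * (cosh t0 - cosh x) - \<sigma> / 4) (at x)"
          by (auto intro!: derivative_eq_intros p')
        ultimately show "\<exists>d. ((\<lambda>s. p s - \<sigma> / 4 * s) has_real_derivative d) (at x) \<and> 0 \<le> d" by blast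
      qed
      moreover have "p (t0 - \<delta>) \<le> \<eta>" using \<delta>t0 by (intro max) auto
      ultimately have "p s \<le> \<eta> + \<sigma> / 4 * s - \<sigma> / 4 * (t0 - \<delta>)" by linarith
      also have "\<dots> = \<eta> + \<sigma> * \<delta> / 4 - \<sigma> / 4 * (t0 - s)" by (simp add: field_simps)
      finally have "p s \<le> \<eta> + \<sigma> * \<delta> / 4 - \<sigma> / 4 * (t0 - s)" .
      then show ?thesis using 1 \<delta> by (simp add: \<sigma>\<delta>)
    next
      case 2
      then have "\<sigma> / 4 * \<bar>s - t0\<bar> \<le> \<sigma> / 4 * \<delta>" using \<sigma> by (intro mult_left_mono) auto
      then show ?thesis using max[OF s] \<sigma>\<delta> by simp
    next
      case 3
      then have "p (t0 + \<delta>) + \<sigma> / 4 * (t0 + \<delta>) \<ge> p s + \<sigma> / 4 * s"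
      proof (rule DERIV_nonpos_imp_nonincreasing)
        fix x assume "t0 + \<delta> \<le> x" "x \<le> s"
        then have "z * (cosh t0 - cosh x) + \<sigma> / 4 \<le> 0" using right[of x] by (simp add: right_diff_distrib)
        moreover have "((\<lambda>s. p s + \<sigma> / 4 * s) has_real_derivative z * (cosh t0 - cosh x) + \<sigma> / 4) (at x)"
          by (auto intro!: derivative_eq_intros p')
        ultimately show "\<exists>d. ((\<lambda>s. p s + \<sigma> / 4 * s) has_real_derivative d) (at x) \<and> d \<le> 0" by blast
      qed
      moreover have "p (t0 + \<delta>) \<le> \<eta>" using t0 \<delta> by (intro max) auto
      ultimately have "p s \<le> \<eta> + \<sigma> / 4 * (t0 + \<delta>) - \<sigma> / 4 * s" by linarith
      also have "\<dots> = \<eta> + \<sigma> * \<delta> / 4 - \<sigma> / 4 * (s - t0)" by (simp add: field_simps)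
      finally have "p s \<le> \<eta> + \<sigma> * \<delta> / 4 - \<sigma> / 4 * (s - t0)" .
      then show ?thesis using 3 \<delta> by (simp add: \<sigma>\<delta>)
    qed
  qed
  have f_eq: "exp (- (- \<nu> * s) - z * sinh s) = exp (p s)" for s by (simp add: p_def)
  have int: "((\<lambda>s. exp (p s)) has_integral bessel_E (- \<nu>) z) {0..}"
    using integrable_integral[OF bessel_E_integrable[OF z, of "- \<nu>"]] by (simp only: f_eq bessel_E_def)
  define m C where "m = \<sigma> / 4" and "C = exp (\<eta> + 1 / 4)"
  have m: "m > 0" using \<sigma> by (simp add: m_def)
  have i1: "((\<lambda>s. exp (- m * \<bar>s - t0\<bar>)) has_integral (1 - exp (- m * t0)) / m) {0..t0}"
  proof -
    have "((\<lambda>s. exp (- m * (t0 - s))) has_integral (exp (- m * (t0 - t0)) / m - exp (- m * (t0 - 0)) / m)) {0..t0}"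
      using t0 m by (intro fundamental_theorem_of_calculus)
        (auto intro!: derivative_eq_intros simp flip: has_real_derivative_iff_has_vector_derivative)
    then show ?thesis by (subst has_integral_cong[of _ _ "\<lambda>s. exp (- m * (t0 - s))"]) (auto simp: diff_divide_distrib)
  qed
  have i2: "((\<lambda>s. exp (- m * \<bar>s - t0\<bar>)) has_integral 1 / m) {t0..}"
  proof -
    have "((\<lambda>s. exp (m * t0) * exp (- m * s)) has_integral (exp (m * t0) * (exp (- m * t0) / m))) {t0..}"
      by (intro has_integral_mult_right has_integral_exp_minus_to_infinity m)
    then have "((\<lambda>s. exp (- m * (s - t0))) has_integral 1 / m) {t0..}"
      by (simp add: right_diff_distrib exp_diff exp_minus field_simps)
    then show ?thesis by (subst has_integral_cong[of _ _ "\<lambda>s. exp (- m * (s - t0))"]) auto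
  qed
  have "((\<lambda>s. exp (- m * \<bar>s - t0\<bar>)) has_integral ((1 - exp (- m * t0)) / m + 1 / m)) ({0..t0} \<union> {t0..})"
  proof (rule has_integral_Un[OF i1 i2])
    show "negligible ({0..t0} \<inter> {t0..})"
      using t0 by (intro negligible_subset[OF negligible_sing[of t0]]) auto
  qed
  moreover have "{0..t0} \<union> {t0..} = {0..}" using t0 by auto
  ultimately have "((\<lambda>s. C * exp (- m * \<bar>s - t0\<bar>)) has_integral C * ((1 - exp (- m * t0)) / m + 1 / m)) {0..}"
    by (intro has_integral_mult_right) simp
  then have "bessel_E (- \<nu>) z \<le> C * ((1 - exp (- m * t0)) / m + 1 / m)"
  proof (rule has_integral_le[OF int])
    show "exp (p s) \<le> C * exp (- m * \<bar>s - t0\<bar>)" if "s \<in> {0..}" for s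
      using tent[of s] that by (simp add: C_def m_def flip: exp_add)
  qed
  also have "\<dots> \<le> C * (1 / m + 1 / m)"
    using m by (intro mult_left_mono add_mono divide_right_mono) (auto simp: C_def)
  also have "\<dots> = 8 * C / \<sigma>" by (simp add: m_def)
  also have "C \<le> 2 * exp \<eta>"
  proof -
    have "exp (1 / 4 :: real) ^ 4 = exp 1" by (simp flip: exp_of_nat_mult)
    then have "exp (1 / 4 :: real) ^ 4 \<le> 2 ^ 4" using exp1[of 1] by simp
    then have "exp (1 / 4 :: real) \<le> 2" using power_le_imp_le_base[of "exp (1 / 4 :: real)" 3 2] by simp
    then have "exp \<eta> * exp (1 / 4) \<le> exp \<eta> * 2" by (intro mult_left_mono) auto
    then show ?thesis by (simp add: C_def exp_add mult.commute)
  qed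
  then have "8 * C / \<sigma> \<le> 16 * exp \<eta> / \<sigma>" using \<sigma> by (intro divide_right_mono) auto
  finally show "bessel_E (- \<nu>) z \<le> 16 * exp \<eta> / \<sigma>" .
  \<comment> \<open>By convexity cosh lies above its tangent at t0, so p' \<le> z sinh t0 \<delta> =
    \<sigma> on this interval of length 1/\<sigma>.\<close>
  have low: "\<eta> - 1 \<le> p s" if s: "t0 - \<delta> \<le> s" "s \<le> t0" for s
  proof -
    have "p s - \<sigma> * s \<ge> p t0 - \<sigma> * t0"
    proof (rule DERIV_nonpos_imp_nonincreasing[OF s(2)])
      fix x assume x: "s \<le> x" "x \<le> t0"
      have "cosh x - sinh t0 * x \<ge> cosh t0 - sinh t0 * t0"
      proof (rule DERIV_nonpos_imp_nonincreasing[OF x(2)])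
        fix y assume "x \<le> y" "y \<le> t0"
        then have "sinh y - sinh t0 \<le> 0" by simp
        moreover have "((\<lambda>x. cosh x - sinh t0 * x) has_real_derivative sinh y - sinh t0) (at y)"
          by (auto intro!: derivative_eq_intros)
        ultimately show "\<exists>d. ((\<lambda>x. cosh x - sinh t0 * x) has_real_derivative d) (at y) \<and> d \<le> 0" by blast
      qed
      then have "cosh t0 - cosh x \<le> sinh t0 * (t0 - x)" by (simp add: right_diff_distrib)
      also have "\<dots> \<le> sinh t0 * \<delta>" using s x t0 by (intro mult_left_mono) auto
      finally have "z * (cosh t0 - cosh x) \<le> z * (sinh t0 * \<delta>)" using z by (intro mult_left_mono) auto
      then have "z * (cosh t0 - cosh x) - \<sigma> \<le> 0" using S\<delta> by simp
      moreover have "((\<lambda>s. p s - \<sigma> * s) has_real_derivative z * (cosh t0 - cosh x) - \<sigma>) (at x)"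
        by (auto intro!: derivative_eq_intros p')
      ultimately show "\<exists>d. ((\<lambda>s. p s - \<sigma> * s) has_real_derivative d) (at x) \<and> d \<le> 0" by blast
    qed
    then have "\<eta> - \<sigma> * (t0 - s) \<le> p s" by (simp add: pt0 right_diff_distrib)
    moreover have "\<sigma> * (t0 - s) \<le> \<sigma> * \<delta>" using s \<sigma> by (intro mult_left_mono) auto
    ultimately show ?thesis by (simp add: \<sigma>\<delta>)
  qed
  have cont: "continuous_on A p" for A unfolding p_def by (intro continuous_intros)
  have sub: "(\<lambda>s. exp (p s)) integrable_on {t0 - \<delta>..t0}"
    by (intro integrable_continuous_interval continuous_intros cont)
  have "exp (\<eta> - 1) / \<sigma> = integral {t0 - \<delta>..t0} (\<lambda>s. exp (\<eta> - 1))"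
    using \<delta> by (simp add: \<delta>_def)
  also have "\<dots> \<le> integral {t0 - \<delta>..t0} (\<lambda>s. exp (p s))"
    using low by (intro integral_le sub) auto
  also have "\<dots> \<le> integral {0..} (\<lambda>s. exp (p s))"
    using \<delta>t0 by (intro integral_subset_le sub has_integral_integrable[OF int]) auto
  also have "\<dots> = bessel_E (- \<nu>) z" using int by (rule integral_unique)
  finally show "exp (\<eta> - 1) / \<sigma> \<le> bessel_E (- \<nu>) z" .
qed

subsection \<open>The exponential region\<close>

text \<open>As z < \<nu> there is no stationary point: P and Q are at most 4/b and E(\<nu>) at most
  1/b, with b = \<nu> - z. The factor 8000000 = 200^3 gives b \<ge> 40\<sigma>, so these errors take
  at most 5/40 of e/\<sigma> from a peak of at least e/(3\<sigma>). What remains is 5/24, which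
  exceeds 4/20 and hence \<pi>/20.\<close>

lemma hankel_exponential_region:
  assumes z: "z \<ge> 1" and \<nu>: "z < \<nu>" and b: "8000000 * \<nu> \<le> (\<nu> - z) ^ 3"
    and \<sigma>: "\<sigma> > 0" "\<sigma> ^ 4 = \<nu>\<^sup>2 - z\<^sup>2"
  shows "exp (eta2 z \<nu>) / (20 * \<sigma>) \<le> cmod (hankel_H1 \<nu> z)"
    and "cmod (hankel_H1 \<nu> z) \<le> 49 * exp (eta2 z \<nu>) / \<sigma>"
proof -
  define b where "b = \<nu> - z"
  have b0: "b > 0" and b3: "8000000 * \<nu> \<le> b ^ 3" using assms by (auto simp: b_def)
  have z0: "z > 0" using z by simp
  have \<nu>0: "\<nu> > 0" using z \<nu> by simp
  have \<sigma>4: "\<sigma> ^ 4 = b * (\<nu> + z)" by (simp add: b_def \<sigma> algebra_simps power2_eq_square)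
  have \<sigma>2: "\<sigma>\<^sup>2 = sqrt (\<nu>\<^sup>2 - z\<^sup>2)" proof -
    have "\<nu>\<^sup>2 - z\<^sup>2 = (\<sigma>\<^sup>2)\<^sup>2" by (simp flip: \<sigma>(2) power_mult)
    then show ?thesis by (simp only: real_sqrt_abs) simp
  qed
  have "(40 * \<sigma>) ^ 4 = 2560000 * (b * (\<nu> + z))" by (simp add: power_mult_distrib \<sigma>4)
  also have "\<dots> \<le> 2560000 * (b * (b ^ 3 / 4000000))"
    using \<nu> b3 b0 by (intro mult_left_mono) auto
  also have "\<dots> \<le> b ^ 4" using b0 by (simp add: eval_nat_numeral)
  finally have \<sigma>b: "40 * \<sigma> \<le> b" using b0 by (intro power_le_imp_le_base[of "40 * \<sigma>" 3]) auto
  have \<sigma>3: "3 * z \<le> \<sigma> ^ 3"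
  proof -
    have "(3 * z) ^ 4 \<le> 8000000 * z * z ^ 3" using z0 by (simp add: eval_nat_numeral)
    also have "\<dots> \<le> b ^ 3 * (\<nu> + z) ^ 3"
      using z0 \<nu> b0 b3 by (intro mult_mono power_mono) auto
    also have "\<dots> = (\<sigma> ^ 4) ^ 3" unfolding \<sigma>4 by (rule power_mult_distrib[symmetric])
    also have "\<dots> = (\<sigma> ^ 3) ^ 4" by (simp flip: power_mult)
    finally show ?thesis using \<sigma>(1) by (intro power_le_imp_le_base[of "3 * z" 3]) auto
  qed
  have \<sigma>1: "\<sigma> \<ge> 1"
  proof (rule ccontr)
    assume "\<not> \<sigma> \<ge> 1"
    then have "\<sigma> ^ 3 \<le> 1" using \<sigma>(1) by (intro power_le_one) auto
    then show False using \<sigma>3 z by linarith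
  qed
  define t0 where "t0 = arcosh (\<nu> / z)"
  have u: "\<nu> / z > 1" using \<nu> z0 by simp
  have t0_eq: "t0 = ln (\<nu> / z + sqrt ((\<nu> / z)\<^sup>2 - 1))" using u by (simp add: t0_def arcosh_real_def)
  have c: "cosh t0 = \<nu> / z" using u by (simp add: t0_def)
  have t0: "t0 > 0" proof -
    have "1 \<le> (\<nu> / z)\<^sup>2" using u by (intro one_le_power) simp
    then have "0 \<le> sqrt ((\<nu> / z)\<^sup>2 - 1)" by simp
    then show ?thesis unfolding t0_eq using u by (intro ln_gt_zero) linarith
  qed
  have "(z * sinh t0)\<^sup>2 = (\<sigma>\<^sup>2)\<^sup>2"
  proof -
    have "(z * sinh t0)\<^sup>2 = z\<^sup>2 * ((\<nu> / z)\<^sup>2 - 1)" by (simp add: power_mult_distrib sinh_square_eq c)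
    also have "\<dots> = \<nu>\<^sup>2 - z\<^sup>2" using z0 by (simp add: power_divide right_diff_distrib)
    finally show ?thesis by (simp flip: \<sigma>(2) power_mult)
  qed
  then have s: "\<sigma>\<^sup>2 = z * sinh t0" using power2_eq_iff_nonneg[of "\<sigma>\<^sup>2" "z * sinh t0"] z0 t0 by simp
  have \<eta>: "eta2 z \<nu> = \<nu> * t0 - \<sigma>\<^sup>2" by (simp add: eta2_def t0_eq \<sigma>2)
  have zc: "\<nu> = z * cosh t0" using z0 by (simp add: c)
  note E = bessel_E_laplace[OF z0 t0 zc \<sigma>1 s \<sigma>3, folded \<eta>]
  define e where "e = exp (eta2 z \<nu>)"
  \<comment> \<open>The error terms carry no exponential factor; e \<ge> 1 allows them to be
    compared with the peak.\<close>
  have e1: "e \<ge> 1" using E(3) by (simp add: e_def)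
  have inv: "1 / b \<le> 1 / (40 * \<sigma>)" using \<sigma>b \<sigma>(1) by (intro divide_left_mono) auto
  have inv': "1 / (40 * \<sigma>) \<le> e / (40 * \<sigma>)" using e1 \<sigma>(1) by (intro divide_right_mono) auto
  have osc: "\<bar>integral {0..pi} (\<lambda>\<theta>. cos (z * sin \<theta> - \<nu> * \<theta> + c))\<bar> \<le> 4 / b" for c
  proof (rule order_trans[OF oscillatory_bound_1])
    show "z * cos \<theta> - \<nu> \<noteq> 0" for \<theta>
      using mult_left_mono[OF cos_le_one[of \<theta>], of z] z0 \<nu> by linarith
    have "1 / (z + \<nu>) \<le> 1 / b" using z0 b0 \<nu>0 by (intro divide_left_mono) (auto simp: b_def)
    then have "2 * (1 / b + 1 / (z + \<nu>)) \<le> 2 * (1 / b + 1 / b)" by (intro mult_left_mono add_left_mono) auto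
    moreover have "\<bar>z * cos 0 - \<nu>\<bar> = b" "\<bar>z * cos pi - \<nu>\<bar> = z + \<nu>" using \<nu> z0 by (auto simp: b_def)
    ultimately show "2 * (1 / \<bar>z * cos 0 - \<nu>\<bar> + 1 / \<bar>z * cos pi - \<nu>\<bar>) \<le> 4 / b" by simp
  qed (use z0 in auto)
  note PQ = bessel_oscillatory_bounds[OF osc]
  have "pi * cmod (hankel_H1 \<nu> z) \<le> 8 * (1 / b) + 3 * (16 * e / \<sigma>)"
    using hankel_upper[OF z0 less_imp_le[OF \<nu>0]] PQ E(2) by (simp add: e_def)
  also have "\<dots> \<le> 8 * (e / (40 * \<sigma>)) + 3 * (16 * e / \<sigma>)" using inv inv' by linarith
  also have "\<dots> \<le> 49 * e / \<sigma>" using e1 \<sigma>(1) by (simp add: field_simps)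
  finally have "pi * cmod (hankel_H1 \<nu> z) \<le> 49 * e / \<sigma>" .
  moreover have "1 * cmod (hankel_H1 \<nu> z) \<le> pi * cmod (hankel_H1 \<nu> z)"
    using pi_gt3 by (intro mult_right_mono) auto
  ultimately show "cmod (hankel_H1 \<nu> z) \<le> 49 * exp (eta2 z \<nu>) / \<sigma>" by (simp add: e_def)
  have "bessel_E \<nu> z \<le> 1 / b"
  proof -
    have "- \<nu> * s - z * sinh s \<le> 0 - b * s" if "s \<ge> 0" for s
    proof -
      have "0 \<le> z * sinh s" "0 \<le> z * s" using z0 that by auto
      then show ?thesis by (simp add: b_def algebra_simps)
    qed
    moreover have "b \<ge> 4" using \<sigma>b \<sigma>1 by linarith
    ultimately have "bessel_E (- (- \<nu>)) z \<le> exp 0 / b" by (intro bessel_E_upper(1) z0) auto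
    then show ?thesis by simp
  qed
  moreover have "exp (- 1) \<ge> (1 / 3 :: real)"
    using exp_le by (simp add: exp_minus field_simps)
  then have "e / 3 / \<sigma> \<le> exp (eta2 z \<nu> - 1) / \<sigma>"
    using mult_left_mono[of "1 / 3" "exp (- 1)" e] e1 \<sigma>(1)
    by (intro divide_right_mono) (auto simp: e_def exp_diff exp_minus field_simps)
  ultimately have "e / 3 / \<sigma> - 1 / b - 4 * (1 / b) \<le> pi * cmod (hankel_H1 \<nu> z)"
    using hankel_lower[OF z0, of \<nu>] PQ(2) E(1) by simp
  moreover have "e / 3 / \<sigma> - 5 * (e / (40 * \<sigma>)) \<le> e / 3 / \<sigma> - 1 / b - 4 * (1 / b)"
    using inv inv' by linarith
  moreover have "e / 3 / \<sigma> - 5 * (e / (40 * \<sigma>)) = (5 / 24) * (e / \<sigma>)" by (simp add: field_simps)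
  moreover have "4 * (e / (20 * \<sigma>)) \<ge> pi * (e / (20 * \<sigma>))" using pi_less_4 e1 \<sigma>(1) by (intro mult_right_mono) auto
  moreover have "4 * (e / (20 * \<sigma>)) \<le> (5 / 24) * (e / \<sigma>)" using e1 \<sigma>(1) by (simp add: field_simps)
  ultimately have "pi * (e / (20 * \<sigma>)) \<le> pi * cmod (hankel_H1 \<nu> z)" by linarith
  then have "e / (20 * \<sigma>) \<le> cmod (hankel_H1 \<nu> z)" by (rule mult_left_le_imp_le) simp
  then show "exp (eta2 z \<nu>) / (20 * \<sigma>) \<le> cmod (hankel_H1 \<nu> z)" by (simp only: e_def)
qed

section \<open>Choice of the constants and assembly of the three regimes\<close>

theorem theorem3p9:
  "\<exists>z0 C0 A0 :: real. z0 \<ge> 1 \<and> C0 > 0 \<and> A0 \<ge> 1 \<and>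
     (\<forall>z \<nu> :: real. z \<ge> z0 \<longrightarrow> \<nu> \<ge> 0 \<longrightarrow>
        ((\<nu> = 0 \<or> (\<nu> > 0 \<and> (z - \<nu>) / \<nu> powr (1/3) \<ge> C0)) \<longrightarrow>
           inverse A0 * (1 / (z\<^sup>2 - \<nu>\<^sup>2) powr (1/4)) \<le> cmod (hankel_H1 \<nu> z) \<and>
           cmod (hankel_H1 \<nu> z) \<le> A0 * (1 / (z\<^sup>2 - \<nu>\<^sup>2) powr (1/4))) \<and>
        ((\<nu> > 0 \<and> \<bar>z - \<nu>\<bar> / \<nu> powr (1/3) \<le> C0) \<longrightarrow>
           inverse A0 * \<nu> powr (-1/3) \<le> cmod (hankel_H1 \<nu> z) \<and>
           cmod (hankel_H1 \<nu> z) \<le> A0 * \<nu> powr (-1/3)) \<and>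
        ((\<nu> > 0 \<and> (\<nu> - z) / \<nu> powr (1/3) \<ge> C0) \<longrightarrow>
           inverse A0 * exp (eta2 z \<nu>) * (1 / (\<nu>\<^sup>2 - z\<^sup>2) powr (1/4)) \<le> cmod (hankel_H1 \<nu> z) \<and>
           cmod (hankel_H1 \<nu> z) \<le> A0 * exp (eta2 z \<nu>) * (1 / (\<nu>\<^sup>2 - z\<^sup>2) powr (1/4))))"
proof -
  \<comment> \<open>The reciprocal of the lower constant at the transition is the largest constant
    that occurs: 7210 = 2 * 3605 from the oscillating integrals, 24 = 3 * 8 from E1.\<close>
  define A0 :: real where "A0 = 7210 + 24 * exp 10050"
  have A0: "A0 \<ge> 7210" "126 + 3 * exp 10050 \<le> A0" by (simp_all add: A0_def)
  have inv: "inverse A0 \<le> 1 / c" if "0 < c" "c \<le> 7210" for c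
    using that A0(1) by (simp add: inverse_eq_divide divide_left_mono)
  have root4: "(x powr (1 / 4)) ^ 4 = x" "x powr (1 / 4) > 0" if "x > 0" for x :: real
    using that by (simp_all add: powr_power)
  have root3: "(x powr (1 / 3)) ^ 3 = x" "x powr (1 / 3) > 0" if "x > 0" for x :: real
    using that by (simp_all add: powr_power)
  have cube: "8000000 * \<nu> \<le> d ^ 3" if "\<nu> > 0" "d / \<nu> powr (1 / 3) \<ge> 200" for d \<nu> :: real
  proof -
    have "200 * \<nu> powr (1 / 3) \<le> d" using that root3(2)[of \<nu>] by (simp add: field_simps)
    then have "(200 * \<nu> powr (1 / 3)) ^ 3 \<le> d ^ 3" using root3(2)[of \<nu>] that(1) by (intro power_mono) auto
    then show ?thesis using root3(1)[OF that(1)] by (simp add: power_mult_distrib)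
  qed
  have 1: "inverse A0 * (1 / (z\<^sup>2 - \<nu>\<^sup>2) powr (1/4)) \<le> cmod (hankel_H1 \<nu> z) \<and>
      cmod (hankel_H1 \<nu> z) \<le> A0 * (1 / (z\<^sup>2 - \<nu>\<^sup>2) powr (1/4))"
    if z: "z \<ge> 228000" and h: "\<nu> = 0 \<or> (\<nu> > 0 \<and> (z - \<nu>) / \<nu> powr (1/3) \<ge> 200)" for z \<nu>
  proof -
    define \<sigma> where "\<sigma> = (z\<^sup>2 - \<nu>\<^sup>2) powr (1/4)"
    have large: "z \<le> d ^ 3" if "z \<le> 2 * d" for d
    proof -
      have "2 * 2 * d \<le> d * d * d" using that z by (intro mult_right_mono mult_mono) auto
      then show ?thesis using that z unfolding power3_eq_cube by linarith
    qed
    have b: "z \<le> (z - \<nu>) ^ 3" and \<nu>: "0 \<le> \<nu>" "\<nu> < z"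
    proof -
      show "0 \<le> \<nu>" using h by auto
      show "\<nu> < z"
      proof (cases "\<nu> = 0")
        case False
        with h have "\<nu> > 0" "(z - \<nu>) / \<nu> powr (1/3) > 0" by auto
        then show ?thesis using root3(2)[of \<nu>] by (simp add: zero_less_divide_iff)
      qed (use z in auto)
      show "z \<le> (z - \<nu>) ^ 3"
      \<comment> \<open>For \<nu> \<le> z/2, including \<nu> = 0, the size of z alone suffices;
        otherwise \<nu> is comparable to z and the cubed hypothesis applies.\<close>
      proof (cases "z \<le> 2 * (z - \<nu>)")
        case True
        then show ?thesis by (rule large)
      next
        case False
        then have "z < 2 * \<nu>" by (simp add: right_diff_distrib)
        moreover from this have "\<nu> > 0" using z by linarith
        ultimately have "8000000 * \<nu> \<le> (z - \<nu>) ^ 3" using h by (intro cube) auto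
        with \<open>z < 2 * \<nu>\<close> \<open>\<nu> > 0\<close> show ?thesis by linarith
      qed
    qed
    have "\<nu>\<^sup>2 < z\<^sup>2" using \<nu> by (intro power_strict_mono) auto
    then have \<sigma>: "\<sigma> > 0" "\<sigma> ^ 4 = z\<^sup>2 - \<nu>\<^sup>2" using root4[of "z\<^sup>2 - \<nu>\<^sup>2"] by (auto simp: \<sigma>_def)
    have z64: "z \<ge> 64" using z by simp
    note H = hankel_oscillatory_region[OF z64 \<nu>(1) less_imp_le[OF \<nu>(2)] b \<sigma>]
    have "inverse A0 * (1 / \<sigma>) \<le> 1 / 46 * (1 / \<sigma>)" using inv[of 46] \<sigma>(1) by (intro mult_right_mono) auto
    moreover have "94 * (1 / \<sigma>) \<le> A0 * (1 / \<sigma>)" using A0(1) \<sigma>(1) by (intro mult_right_mono) auto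
    ultimately show ?thesis using H unfolding \<sigma>_def[symmetric] by simp
  qed
  have 2: "inverse A0 * \<nu> powr (-1/3) \<le> cmod (hankel_H1 \<nu> z) \<and> cmod (hankel_H1 \<nu> z) \<le> A0 * \<nu> powr (-1/3)"
    if z: "z \<ge> 228000" and \<nu>: "\<nu> > 0" and h: "\<bar>z - \<nu>\<bar> / \<nu> powr (1/3) \<le> 200" for z \<nu>
  proof -
    define n where "n = \<nu> powr (1/3)"
    have n0: "n > 0" and n3: "\<nu> = n ^ 3" using root3[OF \<nu>] by (simp_all add: n_def)
    have np: "\<nu> powr (-1/3) = 1 / n" by (simp add: n_def powr_minus_divide)
    have d: "\<bar>z - n ^ 3\<bar> \<le> 200 * n" using h n0 by (simp add: n3 n_def[symmetric, unfolded n3] field_simps)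
    \<comment> \<open>Origin of the threshold: 60^3 + 200 * 60 = 228000.\<close>
    have n: "n \<ge> 60"
    proof (rule ccontr)
      assume "\<not> n \<ge> 60"
      then have "n < 60" by simp
      then have "n ^ 3 < 60 ^ 3" using n0 by (intro power_strict_mono) auto
      then show False using \<open>n < 60\<close> d z unfolding abs_le_iff by simp
    qed
    note H = hankel_transition_region[OF n d]
    have "(126 + 3 * exp 10050) / n \<le> A0 / n" using A0(2) n0 by (intro divide_right_mono) auto
    then show ?thesis using H unfolding np unfolding n3 A0_def[symmetric] by (simp add: inverse_eq_divide)
  qed
  have 3: "inverse A0 * exp (eta2 z \<nu>) * (1 / (\<nu>\<^sup>2 - z\<^sup>2) powr (1/4)) \<le> cmod (hankel_H1 \<nu> z) \<and>
      cmod (hankel_H1 \<nu> z) \<le> A0 * exp (eta2 z \<nu>) * (1 / (\<nu>\<^sup>2 - z\<^sup>2) powr (1/4))"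
    if z: "z \<ge> 228000" and \<nu>: "\<nu> > 0" and h: "(\<nu> - z) / \<nu> powr (1/3) \<ge> 200" for z \<nu>
  proof -
    define \<sigma> e where "\<sigma> = (\<nu>\<^sup>2 - z\<^sup>2) powr (1/4)" and "e = exp (eta2 z \<nu>)"
    have "(\<nu> - z) / \<nu> powr (1/3) > 0" using h by linarith
    then have z\<nu>: "z < \<nu>" using root3(2)[OF \<nu>] by (simp add: zero_less_divide_iff)
    then have "z\<^sup>2 < \<nu>\<^sup>2" using z by (intro power_strict_mono) auto
    then have \<sigma>: "\<sigma> > 0" "\<sigma> ^ 4 = \<nu>\<^sup>2 - z\<^sup>2" using root4[of "\<nu>\<^sup>2 - z\<^sup>2"] by (auto simp: \<sigma>_def)
    have z1: "z \<ge> 1" using z by simp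
    note H = hankel_exponential_region[OF z1 z\<nu> cube[OF \<nu> h] \<sigma>, folded e_def]
    have "inverse A0 * (e * (1 / \<sigma>)) \<le> 1 / 20 * (e * (1 / \<sigma>))"
      using inv[of 20] \<sigma>(1) by (intro mult_right_mono) (auto simp: e_def)
    moreover have "49 * (e * (1 / \<sigma>)) \<le> A0 * (e * (1 / \<sigma>))"
      using A0(1) \<sigma>(1) by (intro mult_right_mono) (auto simp: e_def)
    ultimately show ?thesis using H unfolding \<sigma>_def[symmetric] e_def[symmetric] by simp
  qed
  show ?thesis
    by (rule exI[of _ 228000], rule exI[of _ 200], rule exI[of _ A0]) (use 1 2 3 A0(1) in auto)
qed

end
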